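(* Let $G$ be an infinite finitely generated group and let $2\le p<\infty$. If $\alpha^\#_p(G)>\frac12$ then $G$ is amenable.
   Context: $d_G$ is the left-invariant word metric on $G$ induced by a finite symmetric generating set, and $L_p=L_p([0,1])$. Let $\mathrm{Isom}(L_p)$ be the group of linear isometric automorphisms of $L_p$. Given a homomorphism $\pi:G\to \mathrm{Isom}(L_p)$, a $1$-cocycle with respect to $\pi$ is a map $f:G\to L_p$ with $f(xy)=\pi(x)f(y)+f(x)$ for all $x,y\in G$. A map $\psi:G\to L_p$ is equivariant if $\psi(x)=\pi(x)v+f(x)$ for some homomorphism $\pi:G\to\mathrm{Isom}(L_p)$, some $1$-cocycle $f$ with respect to $\pi$ and some $v\in L_p$ (i.e. $\psi$ is an orbit map of an affine isometric action). $\alpha^\#_p(G)$ is the supremum of all $\alpha\ge 0$ for which there exist a Lipschitz equivariant map $f:G\to L_p$ and $c>0$ such that $\|f(x)-f(y)\|_p\ge c\, d_G(x,y)^\alpha$ for all distinct $x,y\in G$. It does not depend on the generating set. *)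

theory Defs
  imports "HOL-Analysis.Analysis" "HOL-Algebra.Coset" "HOL-Algebra.Generated_Groups"
    "HOL-Algebra.Bij"
begin

section \<open>The space of measurable functions on the unit interval modulo null sets\<close>

abbreviation unit_lebesgue :: "real measure" where
  "unit_lebesgue \<equiv> lebesgue_on {0..1}"

definition ae_eq :: "(real \<Rightarrow> real) \<Rightarrow> (real \<Rightarrow> real) \<Rightarrow> bool" where
  "ae_eq f g \<longleftrightarrow> f \<in> borel_measurable unit_lebesgue \<and> g \<in> borel_measurable unit_lebesgue \<and>
     (AE x in unit_lebesgue. f x = g x)"

quotient_type L0 = "real \<Rightarrow> real" / partial: ae_eq
proof (rule part_equivpI)
  show "\<exists>f. ae_eq f f"
    by (rule exI[of _ "\<lambda>_. 0"]) (simp add: ae_eq_def)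
  show "symp ae_eq"
    by (rule sympI) (auto simp: ae_eq_def elim: AE_mp)
  show "transp ae_eq"
    by (rule transpI) (auto simp: ae_eq_def elim: AE_mp)
qed

instantiation L0 :: real_vector
begin

lift_definition zero_L0 :: L0 is "\<lambda>_. 0"
  by (simp add: ae_eq_def)

lift_definition plus_L0 :: "L0 \<Rightarrow> L0 \<Rightarrow> L0" is "\<lambda>f g x. f x + g x"
  by (auto simp: ae_eq_def)

lift_definition minus_L0 :: "L0 \<Rightarrow> L0 \<Rightarrow> L0" is "\<lambda>f g x. f x - g x"
  by (auto simp: ae_eq_def)

lift_definition uminus_L0 :: "L0 \<Rightarrow> L0" is "\<lambda>f x. - f x"
  by (auto simp: ae_eq_def)

lift_definition scaleR_L0 :: "real \<Rightarrow> L0 \<Rightarrow> L0" is "\<lambda>c f x. c * f x"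
  by (auto simp: ae_eq_def)

instance
  by standard (transfer; auto simp: ae_eq_def algebra_simps)+

end

section \<open>The Banach space \<open>L\<^sub>p([0,1])\<close> and its group of linear isometric automorphisms\<close>

lift_definition Lp_integrable :: "real \<Rightarrow> L0 \<Rightarrow> bool" is
  "\<lambda>p f. integrable unit_lebesgue (\<lambda>x. \<bar>f x\<bar> powr p)"
  by (rule integrable_cong_AE) (auto simp: ae_eq_def)

definition Lp :: "real \<Rightarrow> L0 set" where
  "Lp p = {u. Lp_integrable p u}"

lift_definition Lp_norm :: "real \<Rightarrow> L0 \<Rightarrow> real" is
  "\<lambda>p f. (LINT x|unit_lebesgue. \<bar>f x\<bar> powr p) powr (1 / p)"
  by (rule arg_cong[where f = "\<lambda>t. t powr _"], rule integral_cong_AE)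
     (auto simp: ae_eq_def)

text \<open>As in \<^const>\<open>BijGroup\<close>, an automorphism is an extensional function on \<open>Lp p\<close>, so it is
  determined by its values on \<open>Lp p\<close>; the group operation is composition.\<close>

definition Isom_Lp :: "real \<Rightarrow> (L0 \<Rightarrow> L0) monoid" where
  "Isom_Lp p = (BijGroup (Lp p))
     \<lparr>carrier := {T \<in> Bij (Lp p).
        (\<forall>u\<in>Lp p. \<forall>v\<in>Lp p. T (u + v) = T u + T v) \<and>
        (\<forall>c. \<forall>u\<in>Lp p. T (c *\<^sub>R u) = c *\<^sub>R T u) \<and>
        (\<forall>u\<in>Lp p. Lp_norm p (T u) = Lp_norm p u)}\<rparr>"

definition cocycle_Lp ::
  "('a, 'b) monoid_scheme \<Rightarrow> real \<Rightarrow> ('a \<Rightarrow> L0 \<Rightarrow> L0) \<Rightarrow> ('a \<Rightarrow> L0) \<Rightarrow> bool" where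
  "cocycle_Lp G p \<pi> f \<longleftrightarrow> f \<in> carrier G \<rightarrow> Lp p \<and>
     (\<forall>x\<in>carrier G. \<forall>y\<in>carrier G. f (x \<otimes>\<^bsub>G\<^esub> y) = \<pi> x (f y) + f x)"

definition equivariant_Lp :: "('a, 'b) monoid_scheme \<Rightarrow> real \<Rightarrow> ('a \<Rightarrow> L0) \<Rightarrow> bool" where
  "equivariant_Lp G p \<psi> \<longleftrightarrow>
     (\<exists>\<pi> \<in> hom G (Isom_Lp p). \<exists>f. \<exists>v \<in> Lp p. cocycle_Lp G p \<pi> f \<and>
        (\<forall>x\<in>carrier G. \<psi> x = \<pi> x v + f x))"

section \<open>Word metrics and the equivariant compression exponent\<close>

definition finite_symmetric_generating_set :: "('a, 'b) monoid_scheme \<Rightarrow> 'a set \<Rightarrow> bool" where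
  "finite_symmetric_generating_set G S \<longleftrightarrow>
     finite S \<and> S \<subseteq> carrier G \<and> (\<forall>s\<in>S. inv\<^bsub>G\<^esub> s \<in> S) \<and> generate G S = carrier G"

definition word_length :: "('a, 'b) monoid_scheme \<Rightarrow> 'a set \<Rightarrow> 'a \<Rightarrow> nat" where
  "word_length G S x =
     (LEAST n. \<exists>ws. set ws \<subseteq> S \<and> length ws = n \<and> foldr (\<otimes>\<^bsub>G\<^esub>) ws \<one>\<^bsub>G\<^esub> = x)"

definition word_dist :: "('a, 'b) monoid_scheme \<Rightarrow> 'a set \<Rightarrow> 'a \<Rightarrow> 'a \<Rightarrow> real" where
  "word_dist G S x y = real (word_length G S (inv\<^bsub>G\<^esub> x \<otimes>\<^bsub>G\<^esub> y))"

definition Lipschitz_Lp ::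
  "('a, 'b) monoid_scheme \<Rightarrow> 'a set \<Rightarrow> real \<Rightarrow> ('a \<Rightarrow> L0) \<Rightarrow> bool" where
  "Lipschitz_Lp G S p f \<longleftrightarrow>
     (\<exists>L. \<forall>x\<in>carrier G. \<forall>y\<in>carrier G. Lp_norm p (f x - f y) \<le> L * word_dist G S x y)"

text \<open>The supremum is taken in \<^typ>\<open>ereal\<close>, where it exists without further assumptions.\<close>

definition equivariant_compression_exponent ::
  "('a, 'b) monoid_scheme \<Rightarrow> 'a set \<Rightarrow> real \<Rightarrow> ereal" where
  "equivariant_compression_exponent G S p =
     Sup (ereal ` {\<alpha>. 0 \<le> \<alpha> \<and>
       (\<exists>f c. equivariant_Lp G p f \<and> Lipschitz_Lp G S p f \<and> c > 0 \<and>
          (\<forall>x\<in>carrier G. \<forall>y\<in>carrier G. x \<noteq> y \<longrightarrow>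
             Lp_norm p (f x - f y) \<ge> c * word_dist G S x y powr \<alpha>))})"

section \<open>Amenability\<close>

text \<open>Von Neumann's definition: there is a left-invariant finitely additive probability measure
  on the set of all subsets of the group.\<close>

definition amenable :: "('a, 'b) monoid_scheme \<Rightarrow> bool" where
  "amenable G \<longleftrightarrow> (\<exists>\<mu> :: 'a set \<Rightarrow> real.
     (\<forall>A. A \<subseteq> carrier G \<longrightarrow> 0 \<le> \<mu> A) \<and>
     \<mu> (carrier G) = 1 \<and>
     (\<forall>A B. A \<subseteq> carrier G \<longrightarrow> B \<subseteq> carrier G \<longrightarrow> A \<inter> B = {} \<longrightarrow> \<mu> (A \<union> B) = \<mu> A + \<mu> B) \<and>
     (\<forall>g\<in>carrier G. \<forall>A. A \<subseteq> carrier G \<longrightarrow> \<mu> (g <#\<^bsub>G\<^esub> A) = \<mu> A))"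

end

theory Submission
  imports Defs
begin

text \<open>
  The theorem compares two properties of the random walk driven by the finite symmetric set
  \<open>X = insert \<one> S\<close>. All expectations are finite averages over the words of a given length in
  \<open>X\<close>, so no probability space is needed.

  A cocycle spreads the walk only diffusively. For a word \<open>ws\<close> with product \<open>W\<close>, write \<open>b W\<close> as a
  sum of \<open>\<pi>\<close>-translated increments. Subtracting from each increment its mean, the drift \<open>m\<close>, gives a
  martingale, and what is left is the sum of the vectors \<open>\<pi> W\<^sub>i m\<close> along the partial products \<open>W\<^sub>i\<close>.
  Reading the same path from its end, starting at \<open>W\<close>, gives a second martingale and the negative of
  essentially the same sum. Adding the two readings cancels the drift up to two boundary terms
  (\<open>forward_backward\<close>), so \<open>2 b W\<close> is a sum of two martingales with identically distributed norms
  and a bounded error. Since \<open>p \<ge> 2\<close>, the \<open>p\<close>-th power is smooth enough for martingales in \<open>L\<^sub>p\<close>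
  with bounded increments to satisfy \<open>E \<parallel>M\<^sub>n\<parallel>\<^sup>p = O(n powr (p / 2))\<close>: the first order term of a Taylor
  expansion averages to zero (\<open>powr_smooth\<close>, \<open>Lp_energy_average\<close>, \<open>backward_total_le\<close>). Hence
  \<open>E \<parallel>b W\<parallel>\<^sup>p = O(n powr (p / 2))\<close> (\<open>cocycle_energy_growth\<close>).

  If \<open>\<parallel>b g\<parallel> \<ge> c |g| powr \<alpha>\<close> with \<open>\<alpha> > 1 / 2\<close>, Markov's inequality therefore keeps half of the words
  of length \<open>n\<close> inside a ball of radius \<open>O(n powr (1 / (2 \<alpha>)))\<close>, which is sublinear in \<open>n\<close>
  (\<open>amenable_of_cocycle_growth\<close>).

  Sublinear escape forces amenability. A ball of radius \<open>R\<close> has at most \<open>card X ^ R\<close> elements, so by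
  the Cauchy-Schwarz inequality the \<open>l\<^sup>2\<close> norm of the distribution of the walk does not decay
  exponentially (\<open>collisions_lower_bound\<close>). Thus for some \<open>n\<close> one step of the walk hardly changes that
  norm; by the parallelogram identity the distribution is then nearly invariant in \<open>l\<^sup>2\<close> under each
  generator (\<open>translation_defect\<close>), and its normalised square is nearly invariant in \<open>l\<^sup>1\<close>. A cluster
  point of such measures is an invariant mean (\<open>amenable_of_approximate_invariance\<close>).
\<close>

section \<open>Smoothness of the power function\<close>

lemma powr_mean_value:
  fixes x y q :: real
  assumes "0 < x" "0 < y"
  shows "\<exists>\<xi>>0. \<bar>\<xi> - x\<bar> \<le> \<bar>y - x\<bar> \<and> y powr q - x powr q = q * \<xi> powr (q - 1) * (y - x)"
proof (cases x y rule: linorder_cases)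
  case less
  have "\<exists>z. x < z \<and> z < y \<and> y powr q - x powr q = (y - x) * (q * z powr (q - 1))"
    by (rule MVT2[OF less]) (use assms in \<open>auto intro!: derivative_eq_intros simp: powr_diff\<close>)
  then obtain z where "x < z" "z < y" "y powr q - x powr q = (y - x) * (q * z powr (q - 1))" by blast
  then show ?thesis using assms by (intro exI[of _ z]) auto
next
  case equal
  then show ?thesis using assms by (intro exI[of _ x]) auto
next
  case greater
  have "\<exists>z. y < z \<and> z < x \<and> x powr q - y powr q = (x - y) * (q * z powr (q - 1))"
    by (rule MVT2[OF greater]) (use assms in \<open>auto intro!: derivative_eq_intros simp: powr_diff\<close>)
  then obtain z where "y < z" "z < x" "x powr q - y powr q = (x - y) * (q * z powr (q - 1))" by blast
  then show ?thesis using assms by (intro exI[of _ z]) (auto simp: algebra_simps)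
qed

text \<open>Splitting at \<open>T b\<^sup>2 = a\<^sup>2\<close> distributes the mixed second order term between the two pure powers.
  The weight \<open>T\<close> will be the time horizon of the walk: the coefficient \<open>1 / T\<close> of \<open>\<bar>a\<bar> powr p\<close> costs only a
  constant factor over \<open>T\<close> steps. It replaces Hoelder's inequality in the moment estimates.\<close>

lemma powr_interpolate:
  fixes a b p T :: real
  assumes "2 \<le> p" "1 \<le> T"
  shows "\<bar>a\<bar> powr (p - 2) * b\<^sup>2 \<le> \<bar>a\<bar> powr p / T + T powr (p / 2 - 1) * \<bar>b\<bar> powr p"
proof (cases "a = 0 \<or> b = 0")
  case True
  then show ?thesis using assms by auto
next
  case False
  then have ab: "\<bar>a\<bar> > 0" "\<bar>b\<bar> > 0" by auto
  have pa: "\<bar>a\<bar> powr p = \<bar>a\<bar> powr (p - 2) * a\<^sup>2" 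
    using ab powr_add[of "\<bar>a\<bar>" "p - 2" 2] by (simp add: powr_numeral)
  have pb: "\<bar>b\<bar> powr p = \<bar>b\<bar> powr (p - 2) * b\<^sup>2"
    using ab powr_add[of "\<bar>b\<bar>" "p - 2" 2] by (simp add: powr_numeral)
  show ?thesis
  proof (cases "T * b\<^sup>2 \<le> a\<^sup>2")
    case True
    then have "b\<^sup>2 \<le> a\<^sup>2 / T" using assms by (simp add: field_simps)
    then have "\<bar>a\<bar> powr (p - 2) * b\<^sup>2 \<le> \<bar>a\<bar> powr (p - 2) * (a\<^sup>2 / T)"
      by (intro mult_left_mono) auto
    also have "\<dots> = \<bar>a\<bar> powr p / T" using pa by simp
    also have "\<dots> \<le> \<bar>a\<bar> powr p / T + T powr (p / 2 - 1) * \<bar>b\<bar> powr p" by simp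
    finally show ?thesis .
  next
    case False
    have "\<bar>a\<bar> powr (p - 2) = (a\<^sup>2) powr (p / 2 - 1)"
      using ab powr_powr[of "\<bar>a\<bar>" 2 "p / 2 - 1"] by (simp add: algebra_simps)
    also have "\<dots> \<le> (T * b\<^sup>2) powr (p / 2 - 1)"
      using False assms by (intro powr_mono2) auto
    also have "\<dots> = T powr (p / 2 - 1) * \<bar>b\<bar> powr (p - 2)"
      using ab assms powr_powr[of "\<bar>b\<bar>" 2 "p / 2 - 1"] by (simp add: powr_mult algebra_simps)
    finally have "\<bar>a\<bar> powr (p - 2) * b\<^sup>2 \<le> T powr (p / 2 - 1) * \<bar>b\<bar> powr (p - 2) * b\<^sup>2"
      by (intro mult_right_mono) auto
    then show ?thesis using pb assms by (simp add: mult.assoc add_increasing)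
  qed
qed

definition smooth_const :: "real \<Rightarrow> real" where
  "smooth_const p = p\<^sup>2 * 3 powr p"

text \<open>When \<open>b\<close> is small against \<open>a\<close> this is Taylor's formula to second order, obtained by applying the
  mean value theorem to \<open>t powr p\<close> and then to \<open>t powr (p - 1)\<close>.\<close>

lemma powr_smooth_near:
  fixes a b p :: real
  assumes p: "2 \<le> p" and ab: "0 < a" "2 * \<bar>b\<bar> < a"
  shows "(a + b) powr p \<le> a powr p + p * a powr (p - 1) * b + smooth_const p * (a powr (p - 2) * b\<^sup>2)"
proof -
  have "0 < a + b" using ab by linarith
  then obtain x where x: "0 < x" "\<bar>x - a\<bar> \<le> \<bar>b\<bar>" "(a + b) powr p - a powr p = p * x powr (p - 1) * b"
    using powr_mean_value[of a "a + b" p] ab(1) by auto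
  obtain y where y: "0 < y" "\<bar>y - a\<bar> \<le> \<bar>x - a\<bar>"
      "x powr (p - 1) - a powr (p - 1) = (p - 1) * y powr (p - 2) * (x - a)"
    using powr_mean_value[of a x "p - 1"] ab x(1) by auto
  have "(x - a) * b \<le> \<bar>x - a\<bar> * \<bar>b\<bar>"
    by (metis abs_ge_self abs_mult)
  also have "\<dots> \<le> \<bar>b\<bar> * \<bar>b\<bar>" using x(2) by (intro mult_right_mono) auto
  finally have 1: "(x - a) * b \<le> b\<^sup>2" by (simp add: power2_eq_square)
  have "y powr (p - 2) \<le> (3 * a) powr (p - 2)"
    using y x ab p by (intro powr_mono2) auto
  also have "\<dots> = 3 powr (p - 2) * a powr (p - 2)" using ab by (simp add: powr_mult)
  also have "\<dots> \<le> 3 powr p * a powr (p - 2)" by (intro mult_right_mono powr_mono) auto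
  finally have 2: "y powr (p - 2) \<le> 3 powr p * a powr (p - 2)" .
  have "(a + b) powr p - a powr p - p * a powr (p - 1) * b = p * b * (x powr (p - 1) - a powr (p - 1))"
    using x(3) by (simp add: algebra_simps)
  also have "\<dots> = p * (p - 1) * y powr (p - 2) * ((x - a) * b)"
    unfolding y(3) by (simp add: algebra_simps)
  also have "\<dots> \<le> p * (p - 1) * y powr (p - 2) * b\<^sup>2"
    using 1 p by (intro mult_left_mono) auto
  also have "\<dots> \<le> p * p * (3 powr p * a powr (p - 2)) * b\<^sup>2"
    using 2 p by (intro mult_right_mono mult_mono) auto
  finally show ?thesis by (simp add: smooth_const_def power2_eq_square algebra_simps)
qed

text \<open>When \<open>b\<close> is not small against \<open>a\<close>, every term is comparable to \<open>\<bar>b\<bar> powr p\<close>.\<close>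

lemma powr_smooth_far:
  fixes a b p :: real
  assumes p: "2 \<le> p" and ab: "\<bar>a\<bar> \<le> 2 * \<bar>b\<bar>"
  shows "\<bar>a + b\<bar> powr p \<le> p * sgn a * \<bar>a\<bar> powr (p - 1) * b + smooth_const p * \<bar>b\<bar> powr p"
proof -
  have bb: "\<bar>b\<bar> powr (p - 1) * \<bar>b\<bar> = \<bar>b\<bar> powr p"
    using powr_mult_base[of "\<bar>b\<bar>" "p - 1"] by (simp add: mult.commute)
  have "\<bar>a + b\<bar> powr p \<le> (3 * \<bar>b\<bar>) powr p" using ab p by (intro powr_mono2) auto
  then have 1: "\<bar>a + b\<bar> powr p \<le> 3 powr p * \<bar>b\<bar> powr p" by (simp add: powr_mult)
  have "\<bar>a\<bar> powr (p - 1) \<le> (3 * \<bar>b\<bar>) powr (p - 1)" using ab p by (intro powr_mono2) auto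
  also have "\<dots> = 3 powr (p - 1) * \<bar>b\<bar> powr (p - 1)" by (simp add: powr_mult)
  also have "\<dots> \<le> 3 powr p * \<bar>b\<bar> powr (p - 1)" by (intro mult_right_mono powr_mono) auto
  finally have "\<bar>a\<bar> powr (p - 1) * \<bar>b\<bar> \<le> 3 powr p * \<bar>b\<bar> powr (p - 1) * \<bar>b\<bar>"
    by (intro mult_right_mono) auto
  then have 2: "\<bar>a\<bar> powr (p - 1) * \<bar>b\<bar> \<le> 3 powr p * \<bar>b\<bar> powr p" using bb by (simp add: mult.assoc)
  have "- (sgn a * \<bar>a\<bar> powr (p - 1) * b) \<le> \<bar>sgn a * \<bar>a\<bar> powr (p - 1) * b\<bar>" by simp
  also have "\<dots> \<le> \<bar>a\<bar> powr (p - 1) * \<bar>b\<bar>" by (auto simp: abs_mult sgn_if)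
  also note 2
  finally have "p * (- (sgn a * \<bar>a\<bar> powr (p - 1) * b)) \<le> p * (3 powr p * \<bar>b\<bar> powr p)"
    using p by (intro mult_left_mono) auto
  moreover have "(1 + p) * (3 powr p * \<bar>b\<bar> powr p) \<le> p\<^sup>2 * (3 powr p * \<bar>b\<bar> powr p)"
  proof (rule mult_right_mono)
    have "2 * p \<le> p * p" using p by (intro mult_right_mono) auto
    then show "1 + p \<le> p\<^sup>2" using p unfolding power2_eq_square by linarith
  qed auto
  ultimately show ?thesis using 1 by (simp add: smooth_const_def algebra_simps)
qed

text \<open>The pointwise form of the smoothness of \<open>L\<^sub>p\<close>. Only the middle term on the right has indefinite sign, and
  it is linear in \<open>b\<close>, so it disappears when \<open>b\<close> is averaged over centred increments.\<close>

lemma powr_smooth: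
  fixes a b p T :: real
  assumes p: "2 \<le> p" and T: "1 \<le> T"
  shows "\<bar>a + b\<bar> powr p \<le> (1 + smooth_const p / T) * \<bar>a\<bar> powr p
           + p * sgn a * \<bar>a\<bar> powr (p - 1) * b + smooth_const p * T powr (p / 2 - 1) * \<bar>b\<bar> powr p"
proof -
  have C0: "smooth_const p \<ge> 0" by (simp add: smooth_const_def)
  have T1: "1 \<le> T powr (p / 2 - 1)" using assms by (intro ge_one_powr_ge_zero) auto
  show ?thesis
  proof (cases "\<bar>a\<bar> \<le> 2 * \<bar>b\<bar>")
    case True
    have "1 * (smooth_const p * \<bar>b\<bar> powr p) \<le> T powr (p / 2 - 1) * (smooth_const p * \<bar>b\<bar> powr p)"
      using T1 C0 by (intro mult_right_mono) auto
    moreover have "0 \<le> (1 + smooth_const p / T) * \<bar>a\<bar> powr p" using C0 T by auto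
    ultimately show ?thesis using powr_smooth_far[OF p True] by (simp add: algebra_simps)
  next
    case False
    have near: "\<bar>a + b\<bar> powr p \<le> \<bar>a\<bar> powr p + p * sgn a * \<bar>a\<bar> powr (p - 1) * b
        + smooth_const p * (\<bar>a\<bar> powr (p - 2) * b\<^sup>2)"
    proof (cases "a > 0")
      case True
      then show ?thesis using powr_smooth_near[OF p, of a b] False by auto
    next
      case neg: False
      then have "a < 0" "\<bar>a + b\<bar> = - a + - b" using False by auto
      then show ?thesis using powr_smooth_near[OF p, of "-a" "-b"] False by auto
    qed
    have "smooth_const p * (\<bar>a\<bar> powr (p - 2) * b\<^sup>2)
        \<le> smooth_const p * (\<bar>a\<bar> powr p / T + T powr (p / 2 - 1) * \<bar>b\<bar> powr p)"
      using powr_interpolate[OF p T] C0 by (rule mult_left_mono)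
    then show ?thesis using near by (simp add: algebra_simps)
  qed
qed

lemma powr_add_le:
  fixes a b p :: real
  assumes "0 \<le> p"
  shows "\<bar>a + b\<bar> powr p \<le> 2 powr p * (\<bar>a\<bar> powr p + \<bar>b\<bar> powr p)"
proof -
  have "\<bar>a + b\<bar> powr p \<le> (2 * max \<bar>a\<bar> \<bar>b\<bar>) powr p"
    using assms by (intro powr_mono2) auto
  also have "\<dots> = 2 powr p * max \<bar>a\<bar> \<bar>b\<bar> powr p" by (simp add: powr_mult)
  also have "\<dots> \<le> 2 powr p * (\<bar>a\<bar> powr p + \<bar>b\<bar> powr p)"
    by (intro mult_left_mono) (auto simp: max_def)
  finally show ?thesis .
qed

section \<open>The \<open>p\<close>-th power of the norm on \<open>L\<^sub>p\<close>\<close>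

text \<open>The \<open>p\<close>-th power of the norm. Working with it instead of the norm makes integrals additive and
  allows \<open>Lp_energy_add_le\<close> to stand in for Minkowski's inequality.\<close>

lift_definition Lp_energy :: "real \<Rightarrow> L0 \<Rightarrow> real" is
  "\<lambda>p f. LINT x|unit_lebesgue. \<bar>f x\<bar> powr p"
  by (rule integral_cong_AE) (auto simp: ae_eq_def)

lemma Lp_norm_eq: "Lp_norm p u = Lp_energy p u powr (1 / p)"
  by transfer simp

lemma Lp_energy_nonneg: "0 \<le> Lp_energy p u"
  by transfer simp

lemma Lp_energy_eq:
  assumes "p > 0"
  shows "Lp_energy p u = Lp_norm p u powr p"
  using assms by (simp add: Lp_norm_eq powr_powr Lp_energy_nonneg)

lemma integrable_powr_add:
  fixes f g :: "'x \<Rightarrow> real"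
  assumes p: "0 \<le> p"
    and meas: "f \<in> borel_measurable M" "g \<in> borel_measurable M"
    and int: "integrable M (\<lambda>x. \<bar>f x\<bar> powr p)" "integrable M (\<lambda>x. \<bar>g x\<bar> powr p)"
  shows "integrable M (\<lambda>x. \<bar>f x + g x\<bar> powr p)"
proof (rule Bochner_Integration.integrable_bound)
  show "integrable M (\<lambda>x. 2 powr p * (\<bar>f x\<bar> powr p + \<bar>g x\<bar> powr p))"
    using int by auto
  show "AE x in M. norm (\<bar>f x + g x\<bar> powr p) \<le> norm (2 powr p * (\<bar>f x\<bar> powr p + \<bar>g x\<bar> powr p))"
    using powr_add_le[OF p] by auto
qed (use meas in auto)

lemma subspace_Lp:
  assumes "0 \<le> p"
  shows "subspace (Lp p)"
proof (rule subspaceI)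
  show "0 \<in> Lp p" unfolding Lp_def mem_Collect_eq by transfer simp
next
  fix u v assume "u \<in> Lp p" "v \<in> Lp p"
  then show "u + v \<in> Lp p" unfolding Lp_def mem_Collect_eq
    by (transfer fixing: p) (rule integrable_powr_add[OF assms], simp_all add: ae_eq_def)
next
  fix c u assume "u \<in> Lp p"
  then show "c *\<^sub>R u \<in> Lp p" unfolding Lp_def mem_Collect_eq
    by transfer (simp add: abs_mult powr_mult)
qed

lemma Lp_energy_scaleR: "Lp_energy p (c *\<^sub>R u) = \<bar>c\<bar> powr p * Lp_energy p u"
  by transfer (simp add: abs_mult powr_mult)

lemma Lp_energy_add_le:
  assumes p: "0 \<le> p" and uv: "u \<in> Lp p" "v \<in> Lp p"
  shows "Lp_energy p (u + v) \<le> 2 powr p * (Lp_energy p u + Lp_energy p v)"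
  using uv unfolding Lp_def mem_Collect_eq
proof (transfer fixing: p)
  fix f g assume fg: "ae_eq f f" "ae_eq g g"
    and int: "integrable unit_lebesgue (\<lambda>x. \<bar>f x\<bar> powr p)" "integrable unit_lebesgue (\<lambda>x. \<bar>g x\<bar> powr p)"
  have "(LINT x|unit_lebesgue. \<bar>f x + g x\<bar> powr p)
      \<le> (LINT x|unit_lebesgue. 2 powr p * (\<bar>f x\<bar> powr p + \<bar>g x\<bar> powr p))"
    using int fg by (intro integral_mono integrable_powr_add p powr_add_le) (auto simp: ae_eq_def)
  also have "\<dots> = 2 powr p * ((LINT x|unit_lebesgue. \<bar>f x\<bar> powr p) + (LINT x|unit_lebesgue. \<bar>g x\<bar> powr p))"
    using int by simp
  finally show "(LINT x|unit_lebesgue. \<bar>f x + g x\<bar> powr p)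
      \<le> 2 powr p * ((LINT x|unit_lebesgue. \<bar>f x\<bar> powr p) + (LINT x|unit_lebesgue. \<bar>g x\<bar> powr p))" .
qed

lemma rep_measurable: "rep_L0 u \<in> borel_measurable unit_lebesgue"
  using Quotient3_rep_reflp[OF Quotient3_L0, of u] by (simp add: ae_eq_def)

lemma rep_refl: "ae_eq (rep_L0 u) (rep_L0 u)"
  by (rule Quotient3_rep_reflp[OF Quotient3_L0])

lemma abs_rep: "abs_L0 (rep_L0 u) = u"
  by (rule Quotient3_abs_rep[OF Quotient3_L0])

lemma rep_abs_AE:
  assumes "f \<in> borel_measurable unit_lebesgue"
  shows "AE x in unit_lebesgue. rep_L0 (abs_L0 f) x = f x"
proof -
  have "ae_eq f f" using assms by (simp add: ae_eq_def)
  then have "ae_eq (rep_L0 (abs_L0 f)) f"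
    using rep_abs_rsp_left[OF Quotient3_L0] by blast
  then show ?thesis by (simp add: ae_eq_def)
qed

lemma rep_add_AE: "AE x in unit_lebesgue. rep_L0 (u + v) x = rep_L0 u x + rep_L0 v x"
proof -
  have "u + v = abs_L0 (\<lambda>x. rep_L0 u x + rep_L0 v x)"
    using plus_L0.abs_eq[OF rep_refl rep_refl, of u v] by (simp add: abs_rep)
  then show ?thesis using rep_abs_AE[of "\<lambda>x. rep_L0 u x + rep_L0 v x"] rep_measurable by simp
qed

lemma rep_zero_AE: "AE x in unit_lebesgue. rep_L0 0 x = 0"
  unfolding zero_L0_def using rep_abs_AE[of "\<lambda>_. 0"] by simp

lemma rep_sum_AE:
  assumes "finite X"
  shows "AE x in unit_lebesgue. rep_L0 (\<Sum>i\<in>X. y i) x = (\<Sum>i\<in>X. rep_L0 (y i) x)"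
  using assms
proof (induction X)
  case empty
  then show ?case using rep_zero_AE by simp
next
  case (insert i X)
  have "AE x in unit_lebesgue. rep_L0 (y i + (\<Sum>i\<in>X. y i)) x = rep_L0 (y i) x + rep_L0 (\<Sum>i\<in>X. y i) x"
    by (rule rep_add_AE)
  with insert.IH show ?case
    by eventually_elim (use insert.hyps in simp)
qed

lemma Lp_energy_rep: "Lp_energy p u = (LINT x|unit_lebesgue. \<bar>rep_L0 u x\<bar> powr p)"
  using Lp_energy.abs_eq[OF rep_refl, of p u] by (simp add: abs_rep)

lemma Lp_rep: "u \<in> Lp p \<Longrightarrow> integrable unit_lebesgue (\<lambda>x. \<bar>rep_L0 u x\<bar> powr p)"
  using Lp_integrable.abs_eq[OF rep_refl, of p u] by (simp add: abs_rep Lp_def)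

text \<open>One step of a martingale in \<open>L\<^sub>p\<close>. The inequality \<open>powr_smooth\<close> is summed over \<open>X\<close> at almost every
  point before integrating, so that its linear term vanishes there and the duality map of \<open>L\<^sub>p\<close> never
  has to be integrated.\<close>

lemma Lp_energy_average:
  assumes p: "2 \<le> p" and T: "1 \<le> T" and X: "finite X"
    and v: "v \<in> Lp p" and y: "\<And>i. i \<in> X \<Longrightarrow> y i \<in> Lp p" and y0: "(\<Sum>i\<in>X. y i) = 0"
  shows "(\<Sum>i\<in>X. Lp_energy p (v + y i)) \<le>
     card X * (1 + smooth_const p / T) * Lp_energy p v
     + smooth_const p * T powr (p / 2 - 1) * (\<Sum>i\<in>X. Lp_energy p (y i))"
proof -
  let ?M = "unit_lebesgue" and ?C = "smooth_const p"
  let ?E = "\<lambda>u x. \<bar>rep_L0 u x\<bar> powr p"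
  have vy: "v + y i \<in> Lp p" if "i \<in> X" for i
    using v y[OF that] subspace_Lp[of p] p by (simp add: subspace_add)
  have ptw: "AE x in ?M. (\<Sum>i\<in>X. ?E (v + y i) x)
      \<le> card X * (1 + ?C / T) * ?E v x + ?C * T powr (p / 2 - 1) * (\<Sum>i\<in>X. ?E (y i) x)"
  proof -
    have "AE x in ?M. \<forall>i\<in>X. rep_L0 (v + y i) x = rep_L0 v x + rep_L0 (y i) x"
      using X by (intro AE_finite_allI rep_add_AE)
    moreover have "AE x in ?M. (\<Sum>i\<in>X. rep_L0 (y i) x) = 0"
      using rep_sum_AE[OF X, of y] rep_zero_AE by (auto simp: y0)
    ultimately show ?thesis
    proof eventually_elim
      case (elim x)
      let ?a = "rep_L0 v x"
      have "(\<Sum>i\<in>X. ?E (v + y i) x) \<le> (\<Sum>i\<in>X. (1 + ?C / T) * ?E v x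
           + p * sgn ?a * \<bar>?a\<bar> powr (p - 1) * rep_L0 (y i) x + ?C * T powr (p / 2 - 1) * ?E (y i) x)"
        using elim(1) by (intro sum_mono) (simp only: powr_smooth[OF p T])
      also have "\<dots> = card X * (1 + ?C / T) * ?E v x
          + p * sgn ?a * \<bar>?a\<bar> powr (p - 1) * (\<Sum>i\<in>X. rep_L0 (y i) x)
          + ?C * T powr (p / 2 - 1) * (\<Sum>i\<in>X. ?E (y i) x)"
        by (simp add: sum.distrib sum_distrib_left mult.assoc)
      finally show ?case using elim(2) by simp
    qed
  qed
  have "(\<Sum>i\<in>X. Lp_energy p (v + y i)) = (LINT x|?M. (\<Sum>i\<in>X. ?E (v + y i) x))"
    unfolding Lp_energy_rep using vy by (intro Bochner_Integration.integral_sum[symmetric] Lp_rep)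
  also have "\<dots> \<le> (LINT x|?M. card X * (1 + ?C / T) * ?E v x
      + ?C * T powr (p / 2 - 1) * (\<Sum>i\<in>X. ?E (y i) x))"
    using vy v y ptw
    by (intro integral_mono_AE Bochner_Integration.integrable_add integrable_mult_right
        Bochner_Integration.integrable_sum Lp_rep) auto
  also have "\<dots> = card X * (1 + ?C / T) * (LINT x|?M. ?E v x)
      + ?C * T powr (p / 2 - 1) * (LINT x|?M. (\<Sum>i\<in>X. ?E (y i) x))"
    using v y
    by (subst Bochner_Integration.integral_add)
      (auto intro!: integrable_mult_right Bochner_Integration.integrable_sum Lp_rep)
  also have "(LINT x|?M. (\<Sum>i\<in>X. ?E (y i) x)) = (\<Sum>i\<in>X. LINT x|?M. ?E (y i) x)"
    using y by (intro Bochner_Integration.integral_sum Lp_rep)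
  finally show ?thesis unfolding Lp_energy_rep .
qed

section \<open>Invariant means from approximately invariant measures\<close>

definition finitely_additive_prob :: "'a set \<Rightarrow> ('a set \<Rightarrow> real) \<Rightarrow> bool" where
  "finitely_additive_prob \<Omega> \<nu> \<longleftrightarrow>
     (\<forall>A. A \<subseteq> \<Omega> \<longrightarrow> 0 \<le> \<nu> A) \<and> \<nu> \<Omega> = 1 \<and>
     (\<forall>A B. A \<subseteq> \<Omega> \<longrightarrow> B \<subseteq> \<Omega> \<longrightarrow> A \<inter> B = {} \<longrightarrow> \<nu> (A \<union> B) = \<nu> A + \<nu> B)"

lemma finitely_additive_prob_le_1:
  assumes "finitely_additive_prob \<Omega> \<nu>" "A \<subseteq> \<Omega>"
  shows "\<nu> A \<le> 1"
proof -
  have "A \<inter> (\<Omega> - A) = {}" "\<Omega> - A \<subseteq> \<Omega>" by auto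
  then have "\<nu> (A \<union> (\<Omega> - A)) = \<nu> A + \<nu> (\<Omega> - A)" "0 \<le> \<nu> (\<Omega> - A)"
    using assms unfolding finitely_additive_prob_def by (simp_all del: Un_Diff_cancel)
  moreover have "A \<union> (\<Omega> - A) = \<Omega>" using assms(2) by blast
  moreover have "\<nu> \<Omega> = 1" using assms(1) by (simp add: finitely_additive_prob_def)
  ultimately show ?thesis by (simp only:)
qed

text \<open>By Tychonoff's theorem the sequence has a cluster point for pointwise convergence, and every limit
  that exists along the whole sequence for a continuous functional is attained there.\<close>

lemma cluster_point_of_set_functions:
  fixes \<nu> :: "nat \<Rightarrow> 'a set \<Rightarrow> real"
  assumes "\<And>n A. \<nu> n A \<in> {0..1}"
  obtains \<mu> where "\<And>A. \<mu> A \<in> {0..1}"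
    and "\<And>\<Phi> c. continuous_on UNIV \<Phi> \<Longrightarrow> (\<lambda>n. \<Phi> (\<nu> n)) \<longlonglongrightarrow> (c :: real) \<Longrightarrow> \<Phi> \<mu> = c"
proof -
  let ?K = "PiE UNIV (\<lambda>_. {0..1}) :: ('a set \<Rightarrow> real) set"
  let ?F = "filtermap \<nu> sequentially"
  have "compactin (product_topology (\<lambda>_. euclidean) UNIV) ?K"
    by (subst compactin_PiE) auto
  then have "compact ?K" by (simp add: euclidean_product_topology)
  moreover have "?F \<noteq> bot" by (simp add: filtermap_bot_iff)
  moreover have "eventually (\<lambda>x. x \<in> ?K) ?F"
    using assms by (simp add: eventually_filtermap PiE_UNIV_domain)
  ultimately obtain \<mu> where \<mu>: "\<mu> \<in> ?K" and nb: "inf (nhds \<mu>) ?F \<noteq> bot"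
    unfolding compact_filter by meson
  show ?thesis
  proof
    show "\<mu> A \<in> {0..1}" for A using \<mu> by auto
    fix \<Phi> :: "('a set \<Rightarrow> real) \<Rightarrow> real" and c :: real
    assume "continuous_on UNIV \<Phi>" and lim: "(\<lambda>n. \<Phi> (\<nu> n)) \<longlonglongrightarrow> c"
    then have "(\<Phi> \<longlongrightarrow> \<Phi> \<mu>) (nhds \<mu>)"
      by (simp add: continuous_on_def tendsto_at_iff_tendsto_nhds)
    then have 1: "(\<Phi> \<longlongrightarrow> \<Phi> \<mu>) (inf (nhds \<mu>) ?F)" by (rule tendsto_mono[rotated]) simp
    have "(\<Phi> \<longlongrightarrow> c) ?F" using lim by (simp add: filterlim_filtermap)
    then have 2: "(\<Phi> \<longlongrightarrow> c) (inf (nhds \<mu>) ?F)" by (rule tendsto_mono[rotated]) simp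
    show "\<Phi> \<mu> = c" using tendsto_unique[OF nb 1 2] .
  qed
qed

lemma (in group) invariant_under_generated:
  assumes S: "S \<subseteq> carrier G" "\<And>s. s \<in> S \<Longrightarrow> inv s \<in> S"
    and inv: "\<And>s A. s \<in> S \<Longrightarrow> A \<subseteq> carrier G \<Longrightarrow> \<mu> (s <# A) = \<mu> A"
    and g: "g \<in> generate G S"
  shows "A \<subseteq> carrier G \<Longrightarrow> \<mu> (g <# A) = \<mu> A"
  using g
proof (induction arbitrary: A rule: generate.induct)
  case one
  then show ?case by (simp add: lcos_mult_one)
next
  case (incl h)
  then show ?case by (simp add: inv)
next
  case (inv h)
  then show ?case by (simp add: assms)
next
  case (eng h1 h2)
  then have "h1 \<in> carrier G" "h2 \<in> carrier G"
    using generate_in_carrier[OF S(1)] by auto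
  then have "(h1 \<otimes> h2) <# A = h1 <# (h2 <# A)" "h2 <# A \<subseteq> carrier G"
    using eng.prems by (simp_all add: lcos_m_assoc l_coset_subset_G)
  then show ?case using eng by simp
qed

text \<open>Additivity and asymptotic invariance under one generator are limits of continuous functionals of the
  measure, each involving at most three sets, so they pass to a cluster point.\<close>

lemma (in group) amenable_of_approximate_invariance:
  assumes S: "S \<subseteq> carrier G" "\<And>s. s \<in> S \<Longrightarrow> inv s \<in> S" "generate G S = carrier G"
    and approx: "\<And>\<epsilon>. 0 < \<epsilon> \<Longrightarrow> \<exists>\<nu>. finitely_additive_prob (carrier G) \<nu> \<and>
       (\<forall>s\<in>S. \<forall>A. A \<subseteq> carrier G \<longrightarrow> \<bar>\<nu> (s <# A) - \<nu> A\<bar> \<le> (\<epsilon>::real))"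
  shows "amenable G"
proof -
  have "\<forall>n. \<exists>\<nu>. finitely_additive_prob (carrier G) \<nu> \<and>
       (\<forall>s\<in>S. \<forall>A. A \<subseteq> carrier G \<longrightarrow> \<bar>\<nu> (s <# A) - \<nu> A\<bar> \<le> inverse (real (Suc n)))"
    using approx by (simp del: of_nat_Suc)
  then obtain \<nu>0 where prob: "\<And>n. finitely_additive_prob (carrier G) (\<nu>0 n)"
    and ainv: "\<And>n s A. s \<in> S \<Longrightarrow> A \<subseteq> carrier G \<Longrightarrow>
        \<bar>\<nu>0 n (s <# A) - \<nu>0 n A\<bar> \<le> inverse (real (Suc n))"
    by metis
  \<comment> \<open>Outside the subsets of the carrier the given measures may be unbounded; restricting makes all
    values lie in the unit interval, as compactness requires.\<close>
  define \<nu> where "\<nu> n A = \<nu>0 n (A \<inter> carrier G)" for n A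
  have \<nu>: "\<nu> n A = \<nu>0 n A" if "A \<subseteq> carrier G" for n A
    using that by (simp add: \<nu>_def Int_absorb2)
  have "\<And>n A. \<nu> n A \<in> {0..1}"
    using prob finitely_additive_prob_le_1[OF prob]
    unfolding \<nu>_def finitely_additive_prob_def by simp
  then obtain \<mu> where range: "\<And>A. \<mu> A \<in> {0..1}"
    and lim: "\<And>\<Phi> c. continuous_on UNIV \<Phi> \<Longrightarrow> (\<lambda>n. \<Phi> (\<nu> n)) \<longlonglongrightarrow> (c::real) \<Longrightarrow> \<Phi> \<mu> = c"
    by (rule cluster_point_of_set_functions[of \<nu>]) blast
  have "\<mu> (carrier G) = 1"
    by (rule lim) (use prob in \<open>simp_all add: \<nu> finitely_additive_prob_def\<close>)
  moreover have "\<mu> (A \<union> B) = \<mu> A + \<mu> B"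
    if "A \<subseteq> carrier G" "B \<subseteq> carrier G" "A \<inter> B = {}" for A B
  proof -
    have "\<mu> (A \<union> B) - \<mu> A - \<mu> B = 0"
      by (rule lim) (use prob that in \<open>auto intro!: continuous_intros simp: \<nu> finitely_additive_prob_def\<close>)
    then show ?thesis by simp
  qed
  moreover have inv: "\<mu> (s <# A) = \<mu> A" if s: "s \<in> S" and A: "A \<subseteq> carrier G" for s A
  proof -
    have sA: "s <# A \<subseteq> carrier G" using l_coset_subset_G[OF A, of s] s S(1) by blast
    have "\<mu> (s <# A) - \<mu> A = 0"
    proof (rule lim)
      show "continuous_on UNIV (\<lambda>\<mu> :: 'a set \<Rightarrow> real. \<mu> (s <# A) - \<mu> A)"
        by (intro continuous_intros) auto
      show "(\<lambda>n. \<nu> n (s <# A) - \<nu> n A) \<longlonglongrightarrow> 0"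
      proof (rule Lim_null_comparison)
        show "\<forall>\<^sub>F n in sequentially. norm (\<nu> n (s <# A) - \<nu> n A) \<le> inverse (real (Suc n))"
          using ainv[OF s A] sA A by (simp add: \<nu>)
      qed (rule LIMSEQ_inverse_real_of_nat)
    qed
    then show ?thesis by simp
  qed
  moreover have "\<mu> (g <# A) = \<mu> A" if "g \<in> carrier G" "A \<subseteq> carrier G" for g A
    using invariant_under_generated[OF S(1,2), of \<mu> g A] inv that S(3) by auto
  ultimately show ?thesis
    unfolding amenable_def using range by (intro exI[of _ \<mu>]) auto
qed

section \<open>Collisions of a random walk and amenability\<close>

definition words :: "'a set \<Rightarrow> nat \<Rightarrow> 'a list set" where
  "words X n = {ws. set ws \<subseteq> X \<and> length ws = n}"

lemma words_0: "words X 0 = {[]}"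
  by (auto simp: words_def)

lemma words_Suc: "words X (Suc n) = (\<lambda>(x, ws). x # ws) ` (X \<times> words X n)"
  by (auto simp: words_def length_Suc_conv image_iff)

lemma finite_words: "finite X \<Longrightarrow> finite (words X n)"
  unfolding words_def by (rule finite_lists_length_eq)

lemma card_words: "finite X \<Longrightarrow> card (words X n) = card X ^ n"
  unfolding words_def by (rule card_lists_length_eq)

lemma sum_words_Suc:
  "(\<Sum>ws\<in>words X (Suc n). F ws) = (\<Sum>x\<in>X. \<Sum>ws\<in>words X n. F (x # ws))"
  unfolding words_Suc
  by (subst sum.reindex) (auto simp: inj_on_def sum.cartesian_product case_prod_unfold)

abbreviation word_product :: "('a, 'b) monoid_scheme \<Rightarrow> 'a list \<Rightarrow> 'a" where
  "word_product G ws \<equiv> foldr (\<otimes>\<^bsub>G\<^esub>) ws \<one>\<^bsub>G\<^esub>"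

context group
begin

lemma word_product_closed: "set ws \<subseteq> carrier G \<Longrightarrow> word_product G ws \<in> carrier G"
  by (induction ws) auto

lemma word_product_append:
  assumes "set us \<subseteq> carrier G" "set vs \<subseteq> carrier G"
  shows "word_product G (us @ vs) = word_product G us \<otimes> word_product G vs"
  using assms by (induction us) (auto simp: m_assoc word_product_closed)

lemma word_product_replicate_one: "word_product G (replicate n \<one>) = \<one>"
  by (induction n) auto

end

locale finite_walk = group G for G (structure) +
  fixes X :: "'a set"
  assumes finX: "finite X" and X_carrier: "X \<subseteq> carrier G" and one_X: "\<one> \<in> X"
begin

text \<open>The distribution of the walk after \<open>n\<close> steps, not normalised: the total mass is \<open>card X ^ n\<close>.\<close>

definition hits :: "nat \<Rightarrow> 'a \<Rightarrow> real" where
  "hits n g = (\<Sum>ws\<in>words X n. if word_product G ws = g then 1 else 0)"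

text \<open>As \<open>X\<close> contains \<open>\<one>\<close>, this is the ball of radius \<open>n\<close> around \<open>\<one>\<close> in the word metric of \<open>X\<close>.\<close>

definition reach :: "nat \<Rightarrow> 'a set" where
  "reach n = word_product G ` words X n"

text \<open>The squared \<open>l\<^sup>2\<close> norm of \<open>hits n\<close>, that is, the number of pairs of words of length \<open>n\<close> with the
  same product.\<close>

definition collisions :: "nat \<Rightarrow> real" where
  "collisions n = (\<Sum>g\<in>reach n. (hits n g)\<^sup>2)"

lemma finite_reach: "finite (reach n)"
  by (simp add: reach_def finite_words finX)

lemma card_reach: "card (reach n) \<le> card X ^ n"
  unfolding reach_def using card_image_le[OF finite_words[OF finX]] card_words[OF finX] by metis

lemma reach_carrier: "reach n \<subseteq> carrier G"
  using X_carrier word_product_closed by (force simp: reach_def words_def)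

lemma reach_0: "reach 0 = {\<one>}"
  by (simp add: reach_def words_0)

lemma reach_Suc: "reach (Suc n) = (\<Union>x\<in>X. (\<lambda>g. x \<otimes> g) ` reach n)"
proof -
  have "reach (Suc n) = (\<lambda>(x, ws). x \<otimes> word_product G ws) ` (X \<times> words X n)"
    unfolding reach_def words_Suc image_image by (intro image_cong) auto
  then show ?thesis unfolding reach_def by fastforce
qed

lemma reach_translate: "x \<in> X \<Longrightarrow> g \<in> reach n \<Longrightarrow> x \<otimes> g \<in> reach (Suc n)"
  unfolding reach_Suc by blast

lemma reach_mono: "reach n \<subseteq> reach (Suc n)"
proof
  fix g assume g: "g \<in> reach n"
  then have "g \<in> carrier G" using reach_carrier by blast
  then show "g \<in> reach (Suc n)" using reach_translate[OF one_X g] by simp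
qed

lemma hits_outside: "g \<notin> reach n \<Longrightarrow> hits n g = 0"
  unfolding hits_def reach_def by (intro sum.neutral) auto

lemma hits_Suc:
  assumes g: "g \<in> carrier G"
  shows "hits (Suc n) g = (\<Sum>x\<in>X. hits n (inv x \<otimes> g))"
  unfolding hits_def sum_words_Suc
proof (intro sum.cong refl)
  fix x ws assume "x \<in> X" "ws \<in> words X n"
  then have "x \<in> carrier G" "word_product G ws \<in> carrier G"
    using X_carrier by (auto simp: words_def intro!: word_product_closed)
  then have "word_product G (x # ws) = g \<longleftrightarrow> word_product G ws = inv x \<otimes> g"
    using g inv_solve_left[of "word_product G ws" x g] by auto
  then show "(if word_product G (x # ws) = g then 1 else 0)
      = (if word_product G ws = inv x \<otimes> g then 1 else (0::real))" by simp
qed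

lemma sum_hits:
  assumes "finite F"
  shows "(\<Sum>g\<in>F. hits n g) = card {ws \<in> words X n. word_product G ws \<in> F}"
proof -
  have "(\<Sum>g\<in>F. hits n g)
      = (\<Sum>ws\<in>words X n. \<Sum>g\<in>F. if word_product G ws = g then 1 else 0)"
    unfolding hits_def by (rule sum.swap)
  also have "\<dots> = (\<Sum>ws\<in>words X n. if word_product G ws \<in> F then 1 else 0)"
    using assms by (intro sum.cong refl) simp
  also have "\<dots> = card {ws \<in> words X n. word_product G ws \<in> F}"
    using finite_words[OF finX] by (simp add: sum.If_cases Int_def Collect_conj_eq[symmetric])
  finally show ?thesis .
qed

text \<open>Translation by \<open>x\<close> maps the ball of radius \<open>n\<close> into the ball of radius \<open>Suc n\<close>; with this margin,
  sums over the whole group can be replaced by finite sums.\<close>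

lemma sum_shifted:
  assumes x: "x \<in> X" and A: "A \<subseteq> carrier G"
    and f: "\<And>g. g \<notin> reach n \<Longrightarrow> f g = (0::real)"
  shows "(\<Sum>g\<in>A \<inter> reach (Suc n). f (inv x \<otimes> g)) = (\<Sum>g\<in>reach n. if x \<otimes> g \<in> A then f g else 0)"
proof -
  have xc: "x \<in> carrier G" using x X_carrier by blast
  have "(\<Sum>g\<in>A \<inter> reach (Suc n). f (inv x \<otimes> g))
      = (\<Sum>g\<in>{g\<in>A \<inter> reach (Suc n). inv x \<otimes> g \<in> reach n}. f (inv x \<otimes> g))"
    using f by (intro sum.mono_neutral_right) (auto simp: finite_reach)
  also have "\<dots> = (\<Sum>g\<in>{g\<in>reach n. x \<otimes> g \<in> A}. f g)"
  proof (rule sum.reindex_bij_witness[of _ "\<lambda>g. x \<otimes> g" "\<lambda>g. inv x \<otimes> g"])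
    fix g assume "g \<in> {g \<in> A \<inter> reach (Suc n). inv x \<otimes> g \<in> reach n}"
    then show "x \<otimes> (inv x \<otimes> g) = g" "inv x \<otimes> g \<in> {g \<in> reach n. x \<otimes> g \<in> A}"
      using xc A by (auto simp: m_assoc[symmetric])
  next
    fix g assume g: "g \<in> {g \<in> reach n. x \<otimes> g \<in> A}"
    then have "g \<in> carrier G" using reach_carrier by blast
    then show "inv x \<otimes> (x \<otimes> g) = g" "x \<otimes> g \<in> {g \<in> A \<inter> reach (Suc n). inv x \<otimes> g \<in> reach n}"
      using xc g reach_translate[OF x] by (auto simp: m_assoc[symmetric])
  qed simp
  also have "\<dots> = (\<Sum>g\<in>reach n. if x \<otimes> g \<in> A then f g else 0)"
    by (simp add: sum.If_cases finite_reach Int_def)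
  finally show ?thesis .
qed

lemma sum_square_translate:
  assumes "x \<in> X"
  shows "(\<Sum>g\<in>reach (Suc n). (hits n (inv x \<otimes> g))\<^sup>2) = collisions n"
proof -
  have "carrier G \<inter> reach (Suc n) = reach (Suc n)" using reach_carrier by blast
  then have "(\<Sum>g\<in>reach (Suc n). (hits n (inv x \<otimes> g))\<^sup>2)
      = (\<Sum>g\<in>reach n. if x \<otimes> g \<in> carrier G then (hits n g)\<^sup>2 else 0)"
    using sum_shifted[OF assms, of "carrier G" n "\<lambda>g. (hits n g)\<^sup>2"]
    by (simp add: hits_outside)
  also have "\<dots> = collisions n"
    unfolding collisions_def using assms X_carrier reach_carrier by (intro sum.cong) auto
  finally show ?thesis .
qed

lemma sum_square_differences:
  fixes a :: "'x \<Rightarrow> real"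
  shows "(\<Sum>x\<in>Y. \<Sum>y\<in>Y. (a x - a y)\<^sup>2) = 2 * card Y * (\<Sum>x\<in>Y. (a x)\<^sup>2) - 2 * (\<Sum>x\<in>Y. a x)\<^sup>2"
proof -
  have "(\<Sum>x\<in>Y. \<Sum>y\<in>Y. (a x - a y)\<^sup>2)
      = (\<Sum>x\<in>Y. card Y * (a x)\<^sup>2 + (\<Sum>y\<in>Y. (a y)\<^sup>2) - 2 * (a x * (\<Sum>y\<in>Y. a y)))"
    by (simp add: power2_diff sum.distrib sum_subtractf sum_distrib_left mult.assoc)
  also have "\<dots> = card Y * (\<Sum>x\<in>Y. (a x)\<^sup>2) + card Y * (\<Sum>y\<in>Y. (a y)\<^sup>2)
      - 2 * ((\<Sum>x\<in>Y. a x) * (\<Sum>y\<in>Y. a y))"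
    by (simp only: sum.distrib sum_subtractf sum_distrib_left[symmetric] sum_distrib_right[symmetric] sum_constant)
  finally show ?thesis by (simp add: power2_eq_square)
qed

text \<open>\<open>hits (Suc n)\<close> is the sum of the translates of \<open>hits n\<close> by \<open>X\<close>, which all have the same norm. If the
  norm of the sum is nearly the sum of the norms, then all translates nearly agree, and one of them,
  for \<open>\<one>\<close>, is \<open>hits n\<close> itself.\<close>

lemma translation_defect:
  assumes s: "s \<in> X"
  shows "(\<Sum>g\<in>reach (Suc n). (hits n (inv s \<otimes> g) - hits n g)\<^sup>2)
     \<le> 2 * ((real (card X))\<^sup>2 * collisions n - collisions (Suc n))"
proof -
  let ?F = "reach (Suc n)" and ?l = "\<lambda>x g. hits n (inv x \<otimes> g)"
  let ?d = "\<lambda>x y. \<Sum>g\<in>?F. (?l x g - ?l y g)\<^sup>2"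
  have "(\<Sum>g\<in>?F. (hits n (inv s \<otimes> g) - hits n g)\<^sup>2) = ?d s \<one>"
    using reach_carrier by (intro sum.cong) (auto simp: subset_iff)
  also have "\<dots> \<le> (\<Sum>y\<in>X. ?d s y)"
    using one_X finX by (intro member_le_sum) (auto intro: sum_nonneg)
  also have "\<dots> \<le> (\<Sum>x\<in>X. \<Sum>y\<in>X. ?d x y)"
    using s finX by (intro member_le_sum[of s X "\<lambda>x. \<Sum>y\<in>X. ?d x y"]) (auto intro!: sum_nonneg)
  also have "\<dots> = (\<Sum>g\<in>?F. \<Sum>x\<in>X. \<Sum>y\<in>X. (?l x g - ?l y g)\<^sup>2)"
    by (subst sum.swap[of _ ?F], intro sum.cong refl sum.swap)
  also have "\<dots> = 2 * card X * (\<Sum>g\<in>?F. \<Sum>x\<in>X. (?l x g)\<^sup>2) - 2 * (\<Sum>g\<in>?F. (\<Sum>x\<in>X. ?l x g)\<^sup>2)"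
    unfolding sum_square_differences by (simp add: sum_subtractf sum_distrib_left)
  also have "(\<Sum>g\<in>?F. \<Sum>x\<in>X. (?l x g)\<^sup>2) = card X * collisions n"
    by (subst sum.swap) (simp add: sum_square_translate)
  also have "(\<Sum>g\<in>?F. (\<Sum>x\<in>X. ?l x g)\<^sup>2) = collisions (Suc n)"
    unfolding collisions_def using reach_carrier
    by (intro sum.cong refl) (metis hits_Suc subset_iff)
  finally show ?thesis by (simp add: power2_eq_square algebra_simps)
qed

lemma one_reach: "\<one> \<in> reach n"
proof (induction n)
  case 0
  then show ?case by (simp add: reach_0)
next
  case (Suc n)
  then show ?case using reach_mono by blast
qed

lemma collisions_pos: "0 < collisions n"
proof -
  have "replicate n \<one> \<in> words X n" using one_X by (auto simp: words_def)
  then have "(if word_product G (replicate n \<one>) = \<one> then 1 else 0) \<le> hits n \<one>"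
    unfolding hits_def by (intro member_le_sum) (auto simp: finite_words finX)
  then have "1 \<le> hits n \<one>" by (simp only: word_product_replicate_one if_True refl)
  then have "0 < (hits n \<one>)\<^sup>2" by simp
  also have "\<dots> \<le> collisions n"
    unfolding collisions_def by (intro member_le_sum one_reach) (auto simp: finite_reach)
  finally show ?thesis .
qed

text \<open>The ball of radius \<open>Suc n\<close>, one larger than the support of \<open>hits n\<close>, also contains the supports of
  all translates by \<open>X\<close>.\<close>

definition collision_measure :: "nat \<Rightarrow> 'a set \<Rightarrow> real" where
  "collision_measure n A = (\<Sum>g\<in>A \<inter> reach (Suc n). (hits n g)\<^sup>2) / collisions n"

lemma collisions_alt: "collisions n = (\<Sum>g\<in>reach (Suc n). (hits n g)\<^sup>2)"
  unfolding collisions_def using reach_mono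
  by (intro sum.mono_neutral_left) (auto simp: finite_reach hits_outside)

lemma collision_measure_prob: "finitely_additive_prob (carrier G) (collision_measure n)"
  unfolding finitely_additive_prob_def
proof (intro conjI allI impI)
  show "0 \<le> collision_measure n A" for A
    using collisions_pos[of n] by (auto simp: collision_measure_def intro!: divide_nonneg_pos sum_nonneg)
  show "collision_measure n (carrier G) = 1"
    using collisions_pos[of n] reach_carrier[of "Suc n"]
    by (simp add: collision_measure_def collisions_alt Int_absorb1)
  show "collision_measure n (A \<union> B) = collision_measure n A + collision_measure n B"
    if "A \<inter> B = {}" for A B
  proof -
    have "(\<Sum>g\<in>A \<inter> reach (Suc n) \<union> B \<inter> reach (Suc n). (hits n g)\<^sup>2)
        = (\<Sum>g\<in>A \<inter> reach (Suc n). (hits n g)\<^sup>2) + (\<Sum>g\<in>B \<inter> reach (Suc n). (hits n g)\<^sup>2)"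
      using that by (intro sum.union_disjoint) (auto simp: finite_reach)
    then show ?thesis by (simp add: collision_measure_def Int_Un_distrib2 add_divide_distrib)
  qed
qed

lemma collision_measure_translate:
  assumes s: "s \<in> X" and A: "A \<subseteq> carrier G"
  shows "collision_measure n (inv s <# A)
     = (\<Sum>g\<in>A \<inter> reach (Suc n). (hits n (inv s \<otimes> g))\<^sup>2) / collisions n"
proof -
  have sc: "s \<in> carrier G" using s X_carrier by blast
  have "(\<Sum>g\<in>A \<inter> reach (Suc n). (hits n (inv s \<otimes> g))\<^sup>2)
      = (\<Sum>g\<in>reach n. if s \<otimes> g \<in> A then (hits n g)\<^sup>2 else 0)"
    using sum_shifted[OF s A, of n "\<lambda>g. (hits n g)\<^sup>2"] by (simp add: hits_outside)
  also have "\<dots> = (\<Sum>g\<in>reach n. if g \<in> inv s <# A then (hits n g)\<^sup>2 else 0)"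
  proof (intro sum.cong refl)
    fix g assume "g \<in> reach n"
    then have g: "g \<in> carrier G" using reach_carrier by blast
    have "g \<in> inv s <# A \<longleftrightarrow> s \<otimes> g \<in> A"
    proof
      assume "g \<in> inv s <# A"
      then obtain a where "a \<in> A" "g = inv s \<otimes> a" by (auto simp: l_coset_def)
      then show "s \<otimes> g \<in> A" using A sc by (auto simp: m_assoc[symmetric] subset_iff)
    next
      assume "s \<otimes> g \<in> A"
      moreover have "g = inv s \<otimes> (s \<otimes> g)" using sc g by (simp add: m_assoc[symmetric])
      ultimately show "g \<in> inv s <# A" by (auto simp: l_coset_def)
    qed
    then show "(if s \<otimes> g \<in> A then (hits n g)\<^sup>2 else 0) = (if g \<in> inv s <# A then (hits n g)\<^sup>2 else 0)"
      by simp
  qed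
  also have "\<dots> = (\<Sum>g\<in>(inv s <# A) \<inter> reach n. (hits n g)\<^sup>2)"
    by (simp add: sum.If_cases finite_reach Int_commute)
  also have "\<dots> = (\<Sum>g\<in>(inv s <# A) \<inter> reach (Suc n). (hits n g)\<^sup>2)"
    using reach_mono by (intro sum.mono_neutral_left) (auto simp: finite_reach hits_outside)
  finally show ?thesis by (simp add: collision_measure_def)
qed

text \<open>Squaring passes from near invariance in \<open>l\<^sup>2\<close> to near invariance in \<open>l\<^sup>1\<close>, since
  \<open>a\<^sup>2 - b\<^sup>2 = (a - b) (a + b)\<close>; Young's inequality with weight \<open>\<epsilon>\<close> takes the place of
  Cauchy-Schwarz.\<close>

lemma collision_measure_almost_invariant:
  assumes s: "s \<in> X" and A: "A \<subseteq> carrier G" and \<epsilon>: "0 < \<epsilon>"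
    and decay: "(1 - \<epsilon>\<^sup>2) * (real (card X))\<^sup>2 * collisions n \<le> collisions (Suc n)"
  shows "\<bar>collision_measure n (inv s <# A) - collision_measure n A\<bar> \<le> \<epsilon> * ((real (card X))\<^sup>2 + 2)"
proof -
  let ?F = "reach (Suc n)" and ?k = "real (card X)"
  let ?h = "hits n" and ?l = "\<lambda>g. hits n (inv s \<otimes> g)"
  have young: "\<bar>a\<^sup>2 - b\<^sup>2\<bar> \<le> (a - b)\<^sup>2 / (2 * \<epsilon>) + \<epsilon> * (a\<^sup>2 + b\<^sup>2)" for a b :: real
  proof -
    have "0 \<le> (\<bar>a - b\<bar> - \<epsilon> * \<bar>a + b\<bar>)\<^sup>2" by simp
    then have "2 * \<bar>a - b\<bar> * (\<epsilon> * \<bar>a + b\<bar>) \<le> (a - b)\<^sup>2 + \<epsilon>\<^sup>2 * (a + b)\<^sup>2"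
      by (simp add: power2_diff power_mult_distrib)
    also have "(a + b)\<^sup>2 \<le> 2 * (a\<^sup>2 + b\<^sup>2)"
      using zero_le_power2[of "a - b"] by (simp add: power2_eq_square algebra_simps)
    then have "\<epsilon>\<^sup>2 * (a + b)\<^sup>2 \<le> \<epsilon>\<^sup>2 * (2 * (a\<^sup>2 + b\<^sup>2))" by (rule mult_left_mono) simp
    finally have "2 * \<bar>a - b\<bar> * (\<epsilon> * \<bar>a + b\<bar>) \<le> (a - b)\<^sup>2 + \<epsilon>\<^sup>2 * (2 * (a\<^sup>2 + b\<^sup>2))" by simp
    then have "\<bar>a - b\<bar> * \<bar>a + b\<bar> \<le> (a - b)\<^sup>2 / (2 * \<epsilon>) + \<epsilon> * (a\<^sup>2 + b\<^sup>2)"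
      using \<epsilon> by (simp add: field_simps power2_eq_square)
    moreover have "\<bar>a\<^sup>2 - b\<^sup>2\<bar> = \<bar>a - b\<bar> * \<bar>a + b\<bar>"
      by (simp add: abs_mult[symmetric] power2_eq_square algebra_simps)
    ultimately show ?thesis by simp
  qed
  have "\<bar>\<Sum>g\<in>A \<inter> ?F. (?l g)\<^sup>2 - (?h g)\<^sup>2\<bar> \<le> (\<Sum>g\<in>A \<inter> ?F. \<bar>(?l g)\<^sup>2 - (?h g)\<^sup>2\<bar>)"
    by (rule sum_abs)
  also have "\<dots> \<le> (\<Sum>g\<in>?F. \<bar>(?l g)\<^sup>2 - (?h g)\<^sup>2\<bar>)"
    by (intro sum_mono2) (auto simp: finite_reach)
  also have "\<dots> \<le> (\<Sum>g\<in>?F. (?l g - ?h g)\<^sup>2 / (2 * \<epsilon>) + \<epsilon> * ((?l g)\<^sup>2 + (?h g)\<^sup>2))"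
    by (intro sum_mono young)
  also have "\<dots> = (\<Sum>g\<in>?F. (?l g - ?h g)\<^sup>2) / (2 * \<epsilon>) + \<epsilon> * ((\<Sum>g\<in>?F. (?l g)\<^sup>2) + (\<Sum>g\<in>?F. (?h g)\<^sup>2))"
    by (simp add: sum.distrib sum_divide_distrib sum_distrib_left distrib_left)
  also have "(\<Sum>g\<in>?F. (?l g)\<^sup>2) + (\<Sum>g\<in>?F. (?h g)\<^sup>2) = 2 * collisions n"
    using sum_square_translate[OF s] by (simp add: collisions_alt)
  also have "(\<Sum>g\<in>?F. (?l g - ?h g)\<^sup>2) / (2 * \<epsilon>) \<le> 2 * (\<epsilon>\<^sup>2 * ?k\<^sup>2 * collisions n) / (2 * \<epsilon>)"
  proof (rule divide_right_mono)
    show "(\<Sum>g\<in>?F. (?l g - ?h g)\<^sup>2) \<le> 2 * (\<epsilon>\<^sup>2 * ?k\<^sup>2 * collisions n)"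
      using translation_defect[OF s, of n] decay by (simp add: algebra_simps)
  qed (use \<epsilon> in simp)
  also have "2 * (\<epsilon>\<^sup>2 * ?k\<^sup>2 * collisions n) / (2 * \<epsilon>) = \<epsilon> * ?k\<^sup>2 * collisions n"
    using \<epsilon> by (simp add: power2_eq_square)
  finally have main: "\<bar>\<Sum>g\<in>A \<inter> ?F. (?l g)\<^sup>2 - (?h g)\<^sup>2\<bar> \<le> \<epsilon> * (?k\<^sup>2 + 2) * collisions n"
    by (simp add: algebra_simps)
  have "collision_measure n (inv s <# A) - collision_measure n A
      = (\<Sum>g\<in>A \<inter> ?F. (?l g)\<^sup>2 - (?h g)\<^sup>2) / collisions n"
    unfolding collision_measure_translate[OF s A]
    by (simp add: collision_measure_def sum_subtractf diff_divide_distrib)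
  then show ?thesis
    using main collisions_pos[of n] by (simp add: abs_divide pos_divide_le_eq)
qed

text \<open>The half of Kesten's criterion that is needed: a walk whose one-step \<open>l\<^sup>2\<close> contraction comes
  arbitrarily close to the trivial factor \<open>card X\<close> lives on an amenable group.\<close>

lemma amenable_of_slow_decay:
  assumes sym: "\<And>s. s \<in> X \<Longrightarrow> inv s \<in> X" and gen: "generate G X = carrier G"
    and slow: "\<And>\<rho>. 0 < \<rho> \<Longrightarrow> \<rho> < 1 \<Longrightarrow>
        \<exists>n. \<rho> * (real (card X))\<^sup>2 * collisions n \<le> collisions (Suc n)"
  shows "amenable G"
proof (rule amenable_of_approximate_invariance[OF X_carrier sym gen])
  fix \<epsilon> :: real assume \<epsilon>: "0 < \<epsilon>"
  let ?k = "real (card X)"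
  define \<delta> where "\<delta> = min (1 / 2) (\<epsilon> / (?k\<^sup>2 + 2))"
  have k: "0 < ?k\<^sup>2 + 2" by (simp add: add_nonneg_pos)
  have \<delta>: "\<delta> \<le> 1 / 2" "\<delta> \<le> \<epsilon> / (?k\<^sup>2 + 2)"
    unfolding \<delta>_def by (rule min.cobounded1, rule min.cobounded2)
  have \<delta>0: "0 < \<delta>" using \<epsilon> k by (simp add: \<delta>_def)
  have \<delta>2: "\<delta> * (?k\<^sup>2 + 2) \<le> \<epsilon>" using \<delta>(2) k by (simp add: pos_le_divide_eq)
  have "\<delta>\<^sup>2 \<le> (1 / 2)\<^sup>2" using \<delta>(1) \<delta>0 by (intro power_mono) auto
  then have "0 < 1 - \<delta>\<^sup>2" "1 - \<delta>\<^sup>2 < 1" using \<delta>0 by (auto simp: power2_eq_square)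
  then obtain n where n: "(1 - \<delta>\<^sup>2) * ?k\<^sup>2 * collisions n \<le> collisions (Suc n)"
    using slow by blast
  show "\<exists>\<nu>. finitely_additive_prob (carrier G) \<nu> \<and>
       (\<forall>s\<in>X. \<forall>A. A \<subseteq> carrier G \<longrightarrow> \<bar>\<nu> (s <# A) - \<nu> A\<bar> \<le> \<epsilon>)"
  proof (intro exI[of _ "collision_measure n"] conjI ballI allI impI)
    fix s A assume s: "s \<in> X" and A: "A \<subseteq> carrier G"
    have "inv (inv s) = s" using s X_carrier by auto
    then show "\<bar>collision_measure n (s <# A) - collision_measure n A\<bar> \<le> \<epsilon>"
      using collision_measure_almost_invariant[OF sym[OF s] A \<delta>0 n] \<delta>2 by simp
  qed (rule collision_measure_prob)
qed

text \<open>Cauchy-Schwarz: half of the mass sits on at most \<open>card X ^ R\<close> points.\<close>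

lemma collisions_lower_bound:
  assumes half: "card X ^ n \<le> 2 * card {ws \<in> words X n. word_product G ws \<in> reach R}"
  shows "(real (card X) ^ n)\<^sup>2 \<le> 4 * real (card X) ^ R * collisions n"
proof -
  let ?k = "real (card X)"
  have "real (card X ^ n) \<le> real (2 * card {ws \<in> words X n. word_product G ws \<in> reach R})"
    using half by (simp only: of_nat_le_iff)
  then have "?k ^ n \<le> 2 * (\<Sum>g\<in>reach R. 1 * hits n g)"
    by (simp add: sum_hits finite_reach)
  then have "(?k ^ n)\<^sup>2 \<le> (2 * (\<Sum>g\<in>reach R. 1 * hits n g))\<^sup>2"
    by (intro power_mono) auto
  also have "\<dots> = 4 * (\<Sum>g\<in>reach R. 1 * hits n g)\<^sup>2" by (simp add: power_mult_distrib)
  also have "\<dots> \<le> 4 * ((\<Sum>g\<in>reach R. 1\<^sup>2) * (\<Sum>g\<in>reach R. (hits n g)\<^sup>2))"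
    by (intro mult_left_mono Cauchy_Schwarz_ineq_sum) auto
  also have "\<dots> \<le> 4 * (?k ^ R * collisions n)"
  proof (intro mult_left_mono mult_mono)
    have "real (card (reach R)) \<le> real (card X ^ R)" by (simp only: of_nat_le_iff card_reach)
    then show "(\<Sum>g\<in>reach R. 1\<^sup>2) \<le> ?k ^ R" by simp
    have "(\<Sum>g\<in>reach R. (hits n g)\<^sup>2) = (\<Sum>g\<in>reach R \<inter> reach n. (hits n g)\<^sup>2)"
      by (intro sum.mono_neutral_right) (auto simp: finite_reach hits_outside)
    also have "\<dots> \<le> collisions n"
      unfolding collisions_def by (intro sum_mono2) (auto simp: finite_reach)
    finally show "(\<Sum>g\<in>reach R. (hits n g)\<^sup>2) \<le> collisions n" .
  qed (auto intro: sum_nonneg)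
  finally show ?thesis by simp
qed

lemma collisions_0: "collisions 0 = 1"
  by (simp add: collisions_def reach_0 hits_def words_0)

lemma card_X_pos: "0 < card X"
  using finX one_X by (auto simp: card_gt_0_iff)

text \<open>If every step contracted the squared norm of the normalised distribution by a factor \<open>\<rho> < 1\<close>, then for \<open>L\<close> with
  \<open>\<rho> ^ L \<le> 1 / (2 card X)\<close> the decay after \<open>L R\<close> steps would beat the volume \<open>card X ^ R\<close> of the ball
  by the factor \<open>2 ^ R\<close>, against the lower bound \<open>collisions_lower_bound\<close>. That \<open>R \<ge> 3\<close> makes
  \<open>2 ^ R\<close> exceed the constant \<open>4\<close> there.\<close>

lemma amenable_of_sublinear_escape:
  assumes sym: "\<And>s. s \<in> X \<Longrightarrow> inv s \<in> X" and gen: "generate G X = carrier G"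
    and escape: "\<And>L. 0 < L \<Longrightarrow> \<exists>R\<ge>3. card X ^ (L * R)
        \<le> 2 * card {ws \<in> words X (L * R). word_product G ws \<in> reach R}"
  shows "amenable G"
proof (rule amenable_of_slow_decay[OF sym gen])
  fix \<rho> :: real assume \<rho>: "0 < \<rho>" "\<rho> < 1"
  let ?k = "real (card X)"
  have k: "1 \<le> ?k" using card_X_pos by simp
  show "\<exists>n. \<rho> * ?k\<^sup>2 * collisions n \<le> collisions (Suc n)"
  proof (rule ccontr)
    assume "\<not> ?thesis"
    then have step: "collisions (Suc n) \<le> \<rho> * ?k\<^sup>2 * collisions n" for n
      by (meson linear)
    have upper: "collisions n \<le> \<rho> ^ n * (?k ^ n)\<^sup>2" for n
    proof (induction n)
      case 0
      then show ?case by (simp add: collisions_0)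
    next
      case (Suc n)
      have "collisions (Suc n) \<le> \<rho> * ?k\<^sup>2 * (\<rho> ^ n * (?k ^ n)\<^sup>2)"
        using step[of n] Suc \<rho> by (meson mult_left_mono order_trans zero_le_power2 mult_nonneg_nonneg less_imp_le)
      then show ?case by (simp add: power_mult_distrib algebra_simps)
    qed
    obtain L0 where "\<rho> ^ L0 < 1 / (2 * ?k)"
      using real_arch_pow_inv[of "1 / (2 * ?k)" \<rho>] \<rho> k by auto
    moreover have "1 / (2 * ?k) < 1" using k by simp
    ultimately have L: "\<rho> ^ L0 \<le> 1 / (2 * ?k)" "0 < L0"
      by (auto intro: Nat.gr0I)
    obtain R where R: "3 \<le> R" and half: "card X ^ (L0 * R)
        \<le> 2 * card {ws \<in> words X (L0 * R). word_product G ws \<in> reach R}"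
      using escape[OF L(2)] by blast
    let ?n = "L0 * R"
    have "(?k ^ ?n)\<^sup>2 \<le> 4 * ?k ^ R * collisions ?n" by (rule collisions_lower_bound[OF half])
    also have "\<dots> \<le> 4 * ?k ^ R * (\<rho> ^ ?n * (?k ^ ?n)\<^sup>2)" using upper by (intro mult_left_mono) auto
    finally have "1 * (?k ^ ?n)\<^sup>2 \<le> 4 * ?k ^ R * \<rho> ^ ?n * (?k ^ ?n)\<^sup>2" by (simp only: mult_1 mult.assoc)
    then have "1 \<le> 4 * ?k ^ R * \<rho> ^ ?n"
      by (rule mult_right_le_imp_le) (use k in simp)
    also have "\<rho> ^ ?n = (\<rho> ^ L0) ^ R" by (simp add: power_mult)
    also have "4 * ?k ^ R * (\<rho> ^ L0) ^ R \<le> 4 * ?k ^ R * (1 / (2 * ?k)) ^ R"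
      using L \<rho> by (intro mult_left_mono power_mono) auto
    also have "\<dots> = 4 * (1 / 2) ^ R"
      using k by (simp add: power_divide power_mult_distrib)
    also have "(1 / 2 :: real) ^ R \<le> (1 / 2) ^ 3" using R by (intro power_decreasing) auto
    finally show False by (simp add: power3_eq_cube)
  qed
qed

end

section \<open>Growth of cocycles along the random walk\<close>

text \<open>The affine isometric action \<open>u \<mapsto> \<pi> g u + b g\<close>, together with the steps of a walk on the group.\<close>

locale Lp_cocycle_walk = finite_walk G X for G (structure) and X +
  fixes p :: real and \<pi> :: "'a \<Rightarrow> L0 \<Rightarrow> L0" and b :: "'a \<Rightarrow> L0"
  assumes p: "2 \<le> p"
    and inv_X: "\<And>x. x \<in> X \<Longrightarrow> inv x \<in> X"
    and \<pi>_closed: "\<And>g u. g \<in> carrier G \<Longrightarrow> u \<in> Lp p \<Longrightarrow> \<pi> g u \<in> Lp p"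
    and \<pi>_add: "\<And>g u v. g \<in> carrier G \<Longrightarrow> u \<in> Lp p \<Longrightarrow> v \<in> Lp p \<Longrightarrow> \<pi> g (u + v) = \<pi> g u + \<pi> g v"
    and \<pi>_energy: "\<And>g u. g \<in> carrier G \<Longrightarrow> u \<in> Lp p \<Longrightarrow> Lp_energy p (\<pi> g u) = Lp_energy p u"
    and \<pi>_mult: "\<And>g h u. g \<in> carrier G \<Longrightarrow> h \<in> carrier G \<Longrightarrow> u \<in> Lp p \<Longrightarrow> \<pi> (g \<otimes> h) u = \<pi> g (\<pi> h u)"
    and \<pi>_one: "\<And>u. u \<in> Lp p \<Longrightarrow> \<pi> \<one> u = u"
    and b_closed: "\<And>g. g \<in> carrier G \<Longrightarrow> b g \<in> Lp p"
    and b_mult: "\<And>g h. g \<in> carrier G \<Longrightarrow> h \<in> carrier G \<Longrightarrow> b (g \<otimes> h) = \<pi> g (b h) + b g"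
begin

lemma sub: "subspace (Lp p)"
  using subspace_Lp p by simp

lemmas Lp_closed = subspace_add[OF sub] subspace_diff[OF sub] subspace_scale[OF sub]
  subspace_neg[OF sub] subspace_0[OF sub] \<pi>_closed b_closed

lemma \<pi>_zero: "g \<in> carrier G \<Longrightarrow> \<pi> g 0 = 0"
  using \<pi>_add[of g 0 0] Lp_closed by simp

lemma \<pi>_minus: "g \<in> carrier G \<Longrightarrow> u \<in> Lp p \<Longrightarrow> \<pi> g (- u) = - \<pi> g u"
  using \<pi>_add[of g u "- u"] \<pi>_zero[of g] Lp_closed by (simp add: add_eq_0_iff)

lemma b_one: "b \<one> = 0"
  using b_mult[of \<one> \<one>] \<pi>_one[OF b_closed[of \<one>]] by simp

lemma b_inv: "g \<in> carrier G \<Longrightarrow> \<pi> g (b (inv g)) = - b g"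
  using b_mult[of g "inv g"] b_one by (simp add: eq_neg_iff_add_eq_0)

lemma \<pi>_inv: "g \<in> carrier G \<Longrightarrow> u \<in> Lp p \<Longrightarrow> \<pi> g (\<pi> (inv g) u) = u"
  using \<pi>_mult[of g "inv g" u] \<pi>_one by simp

definition drift :: L0 where
  "drift = (1 / real (card X)) *\<^sub>R (\<Sum>x\<in>X. b x)"

lemma drift_closed: "drift \<in> Lp p"
  unfolding drift_def using X_carrier
  by (intro subspace_scale[OF sub] subspace_sum[OF sub] b_closed) auto

text \<open>For a word with partial products \<open>W\<^sub>1, \<dots>, W\<^sub>n\<close> this is \<open>b W\<^sub>n\<close> plus the sum of the vectors
  \<open>\<pi> W\<^sub>i drift\<close>. As a function of a growing prefix it is not a martingale, but
  \<open>backward_energy_Cons\<close> shows that its norm evolves like that of a martingale when letters are added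
  in front, which is the walk seen from its end point.\<close>

primrec backward :: "'a list \<Rightarrow> L0" where
  "backward [] = 0"
| "backward (x # ws) = b x + \<pi> x (backward ws + drift)"

lemma backward_closed: "set ws \<subseteq> carrier G \<Longrightarrow> backward ws \<in> Lp p"
  by (induction ws) (auto intro!: Lp_closed drift_closed)

lemma words_carrier: "ws \<in> words X n \<Longrightarrow> set ws \<subseteq> carrier G"
  using X_carrier by (auto simp: words_def)

text \<open>Applying the isometry \<open>\<pi> (inv x)\<close> removes \<open>\<pi> x\<close> and turns \<open>b x\<close> into \<open>- b (inv x)\<close>. The new summand
  averages to zero over \<open>x\<close>, because \<open>X\<close> is closed under inverses.\<close>

lemma backward_energy_Cons:
  assumes x: "x \<in> X" and ws: "set ws \<subseteq> carrier G"
  shows "Lp_energy p (backward (x # ws)) = Lp_energy p (backward ws + (drift - b (inv x)))"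
proof -
  have xc: "x \<in> carrier G" using x X_carrier by blast
  note cl = Lp_closed xc backward_closed[OF ws] drift_closed
  have "\<pi> x (backward ws + (drift - b (inv x))) = \<pi> x (backward ws + drift) + \<pi> x (- b (inv x))"
    using \<pi>_add[of x "backward ws + drift" "- b (inv x)"] cl by (simp add: add_diff_eq)
  also have "\<dots> = backward (x # ws)" using \<pi>_minus b_inv cl by simp
  finally show ?thesis using \<pi>_energy[of x "backward ws + (drift - b (inv x))"] cl by simp
qed

lemma backward_increments_centered: "(\<Sum>x\<in>X. drift - b (inv x)) = 0"
proof -
  have "(\<Sum>x\<in>X. b (inv x)) = (\<Sum>x\<in>X. b x)"
    using inv_X X_carrier by (intro sum.reindex_bij_witness[of _ "m_inv G" "m_inv G"]) auto
  then show ?thesis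
    using card_X_pos by (simp add: sum_subtractf drift_def sum_constant_scaleR)
qed

definition backward_total :: "nat \<Rightarrow> real" where
  "backward_total n = (\<Sum>ws\<in>words X n. Lp_energy p (backward ws))"

definition increment_total :: real where
  "increment_total = (\<Sum>x\<in>X. Lp_energy p (drift - b (inv x)))"

lemma increment_total_nonneg: "0 \<le> increment_total"
  unfolding increment_total_def by (intro sum_nonneg Lp_energy_nonneg)

lemma backward_total_Suc:
  assumes T: "1 \<le> T"
  shows "backward_total (Suc n) \<le> card X * (1 + smooth_const p / T) * backward_total n
      + card X ^ n * (smooth_const p * T powr (p / 2 - 1) * increment_total)"
proof -
  have "backward_total (Suc n) = (\<Sum>ws\<in>words X n. \<Sum>x\<in>X. Lp_energy p (backward (x # ws)))"
    unfolding backward_total_def sum_words_Suc by (rule sum.swap)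
  also have "\<dots> = (\<Sum>ws\<in>words X n. \<Sum>x\<in>X. Lp_energy p (backward ws + (drift - b (inv x))))"
    by (intro sum.cong refl backward_energy_Cons words_carrier)
  also have "\<dots> \<le> (\<Sum>ws\<in>words X n. card X * (1 + smooth_const p / T) * Lp_energy p (backward ws)
      + smooth_const p * T powr (p / 2 - 1) * increment_total)"
    unfolding increment_total_def
  proof (intro sum_mono Lp_energy_average p T finX backward_increments_centered)
    show "backward ws \<in> Lp p" if "ws \<in> words X n" for ws
      using words_carrier[OF that] by (rule backward_closed)
    show "drift - b (inv x) \<in> Lp p" if "x \<in> X" for x
      using that X_carrier by (auto intro!: Lp_closed drift_closed)
  qed
  also have "\<dots> = card X * (1 + smooth_const p / T) * backward_total n
      + card X ^ n * (smooth_const p * T powr (p / 2 - 1) * increment_total)"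
    by (simp add: sum.distrib backward_total_def sum_distrib_left card_words finX)
  finally show ?thesis .
qed

lemma smooth_const_nonneg: "0 \<le> smooth_const p"
  by (simp add: smooth_const_def)

text \<open>Iterating \<open>backward_total_Suc\<close> with a fixed \<open>T\<close>. At \<open>n = T\<close> the factors \<open>1 + smooth_const p / T\<close>
  multiply to at most \<open>exp (smooth_const p)\<close>, which leaves \<open>n * n powr (p / 2 - 1)\<close>.\<close>

lemma backward_total_le_horizon:
  assumes T: "1 \<le> T"
  shows "backward_total n \<le> n * ((1 + smooth_const p / T) * card X) ^ n
      * (smooth_const p * T powr (p / 2 - 1) * increment_total)"
proof (induction n)
  case 0
  have "Lp_energy p (0 :: L0) = 0" using Lp_energy_scaleR[of p 0 0] by simp
  then show ?case by (simp add: backward_total_def words_0)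
next
  case (Suc n)
  let ?q = "1 + smooth_const p / T" and ?k = "real (card X)"
  let ?K = "smooth_const p * T powr (p / 2 - 1) * increment_total"
  have q: "1 \<le> ?q" using T smooth_const_nonneg by simp
  have k: "1 \<le> ?k" using card_X_pos by simp
  have K: "0 \<le> ?K" using smooth_const_nonneg increment_total_nonneg by simp
  have qk: "0 \<le> ?k * ?q" using q k by simp
  have "?k ^ n \<le> (?q * ?k) ^ n" using q k by (intro power_mono) auto
  also have "\<dots> \<le> (?q * ?k) ^ Suc n"
  proof (rule power_increasing)
    show "1 \<le> ?q * ?k" using mult_mono[OF q k] q by simp
  qed simp
  finally have "?k ^ n * ?K \<le> (?q * ?k) ^ Suc n * ?K" using K by (rule mult_right_mono)
  moreover have "?k * ?q * backward_total n \<le> ?k * ?q * (n * (?q * ?k) ^ n * ?K)"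
    using Suc qk by (rule mult_left_mono)
  ultimately have "backward_total (Suc n) \<le> ?k * ?q * (n * (?q * ?k) ^ n * ?K) + (?q * ?k) ^ Suc n * ?K"
    using backward_total_Suc[OF T, of n] unfolding of_nat_power by linarith
  also have "x * y * (n * (y * x) ^ n * z) + (y * x) ^ Suc n * z = Suc n * (y * x) ^ Suc n * z"
    for x y z :: real
    by (simp add: algebra_simps)
  finally show ?case .
qed

lemma backward_total_le:
  assumes n: "0 < n"
  shows "backward_total n \<le> card X ^ n * (exp (smooth_const p) * smooth_const p * increment_total * n powr (p / 2))"
proof -
  let ?C = "smooth_const p" and ?D = increment_total
  have "(1 + ?C / n) ^ n \<le> exp ?C"
    using smooth_const_nonneg n by (intro exp_ge_one_plus_x_over_n_power_n) auto
  then have 1: "(1 + ?C / n) ^ n * (card X ^ n * (?C * ?D * n powr (p / 2)))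
      \<le> exp ?C * (card X ^ n * (?C * ?D * n powr (p / 2)))"
    using smooth_const_nonneg increment_total_nonneg by (intro mult_right_mono) auto
  have "real n * real n powr (p / 2 - 1) = real n powr (p / 2)"
    using powr_mult_base[of "real n" "p / 2 - 1"] by simp
  moreover have "n * ((1 + ?C / n) * card X) ^ n * (?C * n powr (p / 2 - 1) * ?D)
      = (1 + ?C / n) ^ n * (card X ^ n * (?C * ?D * (n * n powr (p / 2 - 1))))"
    unfolding of_nat_power power_mult_distrib by (simp only: mult_ac)
  ultimately have 2: "n * ((1 + ?C / n) * card X) ^ n * (?C * n powr (p / 2 - 1) * ?D)
      = (1 + ?C / n) ^ n * (card X ^ n * (?C * ?D * n powr (p / 2)))"
    by (simp only:)
  have "1 \<le> real n" using n by simp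
  from backward_total_le_horizon[OF this, of n] 1
  show ?thesis unfolding 2 by (simp add: mult_ac)
qed

definition inverse_word :: "'a list \<Rightarrow> 'a list" where
  "inverse_word ws = rev (map (m_inv G) ws)"

lemma inverse_word_carrier: "set ws \<subseteq> carrier G \<Longrightarrow> set (inverse_word ws) \<subseteq> carrier G"
  by (auto simp: inverse_word_def subset_iff)

lemma inverse_word_words: "ws \<in> words X n \<Longrightarrow> inverse_word ws \<in> words X n"
  using inv_X by (auto simp: inverse_word_def words_def)

lemma inverse_word_involution:
  assumes "set ws \<subseteq> carrier G"
  shows "inverse_word (inverse_word ws) = ws"
  using assms by (induction ws) (auto simp: inverse_word_def)

lemma backward_snoc:
  assumes "set ws \<subseteq> carrier G" "y \<in> carrier G"
  shows "backward (ws @ [y]) = backward ws + \<pi> (word_product G ws) (b y + \<pi> y drift)"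
  using assms
proof (induction ws)
  case Nil
  then show ?case by (simp add: \<pi>_one Lp_closed drift_closed)
next
  case (Cons x ws)
  let ?W = "word_product G ws" and ?r = "b y + \<pi> y drift"
  have c: "x \<in> carrier G" "?W \<in> carrier G" "?r \<in> Lp p" "\<pi> ?W ?r \<in> Lp p" "backward ws \<in> Lp p"
    using Cons.prems by (auto intro!: Lp_closed drift_closed word_product_closed backward_closed)
  have "backward ((x # ws) @ [y]) = b x + \<pi> x ((backward ws + drift) + \<pi> ?W ?r)"
    using Cons by (simp add: algebra_simps)
  also have "\<dots> = b x + (\<pi> x (backward ws + drift) + \<pi> x (\<pi> ?W ?r))"
    using c by (subst \<pi>_add) (auto intro!: Lp_closed drift_closed)
  also have "\<pi> x (\<pi> ?W ?r) = \<pi> (x \<otimes> ?W) ?r" using \<pi>_mult c by simp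
  finally show ?case by simp
qed

text \<open>The cancellation of the drift. The martingale read along the path is
  \<open>- \<pi> W (backward (inverse_word ws))\<close>, because the inverse word is the path seen from its end point.
  It contains the vectors \<open>\<pi> W\<^sub>i drift\<close> for \<open>i < n\<close> with a minus sign and \<open>backward ws\<close> contains
  those for \<open>1 \<le> i\<close> up to \<open>n\<close> with a plus sign, so that only the two end terms survive.\<close>

lemma forward_backward:
  assumes "set ws \<subseteq> carrier G"
  shows "2 *\<^sub>R b (word_product G ws) = backward ws - \<pi> (word_product G ws) (backward (inverse_word ws))
     + drift - \<pi> (word_product G ws) drift"
  using assms
proof (induction ws)
  case Nil
  then show ?case by (simp add: b_one inverse_word_def \<pi>_one Lp_closed drift_closed)
next
  case (Cons x ws)
  let ?W = "word_product G ws" and ?N = "backward ws" and ?M = "backward (inverse_word ws)"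
  have xc: "x \<in> carrier G" and wsc: "set ws \<subseteq> carrier G" using Cons.prems by auto
  have Wc: "?W \<in> carrier G" using wsc by (rule word_product_closed)
  have iwc: "set (inverse_word ws) \<subseteq> carrier G" using wsc by (rule inverse_word_carrier)
  have N: "?N \<in> Lp p" using wsc by (rule backward_closed)
  have M: "?M \<in> Lp p" using iwc by (rule backward_closed)
  have Winv: "word_product G (inverse_word ws) = inv ?W"
    using wsc
  proof (induction ws)
    case Nil
    then show ?case by (simp add: inverse_word_def)
  next
    case (Cons x ws)
    have "set (inverse_word ws) \<subseteq> carrier G" using Cons.prems by (auto intro!: inverse_word_carrier)
    then show ?case using Cons word_product_append[of "inverse_word ws" "[inv x]"]
      by (simp add: inverse_word_def inv_mult_group word_product_closed)
  qed
  have "\<pi> ?W (backward (inverse_word (x # ws))) = \<pi> ?W (?M + \<pi> (inv ?W) (b (inv x) + \<pi> (inv x) drift))"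
    using backward_snoc[OF iwc, of "inv x"] xc Winv by (simp add: inverse_word_def)
  also have "\<dots> = \<pi> ?W ?M + (b (inv x) + \<pi> (inv x) drift)"
    using M Wc xc by (simp add: \<pi>_add \<pi>_inv Lp_closed drift_closed)
  finally have "\<pi> x (\<pi> ?W (backward (inverse_word (x # ws))))
      = \<pi> x (\<pi> ?W ?M) + (\<pi> x (b (inv x)) + \<pi> x (\<pi> (inv x) drift))"
    using M Wc xc by (simp add: \<pi>_add Lp_closed drift_closed)
  also have "\<dots> = \<pi> x (\<pi> ?W ?M) - b x + drift"
    using xc by (simp add: b_inv \<pi>_inv drift_closed)
  finally have "\<pi> x (\<pi> ?W (backward (inverse_word (x # ws)))) = \<pi> x (\<pi> ?W ?M) - b x + drift" .
  moreover have "\<pi> (x \<otimes> ?W) (backward (inverse_word (x # ws))) = \<pi> x (\<pi> ?W (backward (inverse_word (x # ws))))"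
    using xc Wc wsc by (intro \<pi>_mult backward_closed inverse_word_carrier) auto
  ultimately have inverse: "\<pi> (x \<otimes> ?W) (backward (inverse_word (x # ws))) = \<pi> x (\<pi> ?W ?M) - b x + drift"
    by simp
  have \<pi>d: "\<pi> (x \<otimes> ?W) drift = \<pi> x (\<pi> ?W drift)" using xc Wc drift_closed by (rule \<pi>_mult)
  have "\<pi> x (b ?W) + \<pi> x (b ?W) = \<pi> x (2 *\<^sub>R b ?W)"
    using xc Wc by (simp add: \<pi>_add Lp_closed scaleR_2)
  also have "\<dots> = \<pi> x ((?N + drift) + - \<pi> ?W (?M) + - \<pi> ?W drift)"
    by (simp only: Cons.IH[OF wsc]) (simp add: algebra_simps)
  also have "\<dots> = \<pi> x (?N + drift) - \<pi> x (\<pi> ?W ?M) - \<pi> x (\<pi> ?W drift)"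
    using xc Wc N M by (simp add: \<pi>_add \<pi>_minus Lp_closed drift_closed del: add_uminus_conv_diff)
  finally have double: "\<pi> x (b ?W) + \<pi> x (b ?W) = \<pi> x (?N + drift) - \<pi> x (\<pi> ?W ?M) - \<pi> x (\<pi> ?W drift)" .
  have "2 *\<^sub>R b (x \<otimes> ?W) = (\<pi> x (b ?W) + \<pi> x (b ?W)) + b x + b x"
    using b_mult[OF xc Wc] by (simp add: scaleR_2 algebra_simps)
  moreover have "word_product G (x # ws) = x \<otimes> ?W" by simp
  ultimately show ?case unfolding double by (simp only: inverse \<pi>d) (simp add: algebra_simps)
qed

lemma cocycle_energy_le:
  assumes "set ws \<subseteq> carrier G"
  shows "Lp_energy p (b (word_product G ws)) \<le> 2 powr p *
     (Lp_energy p (backward ws) + Lp_energy p (backward (inverse_word ws)) + 2 * Lp_energy p drift)"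
proof -
  let ?W = "word_product G ws" and ?N = "backward ws" and ?M = "backward (inverse_word ws)"
  have W: "?W \<in> carrier G" using assms by (rule word_product_closed)
  have N: "?N \<in> Lp p" and M: "?M \<in> Lp p"
    using assms by (auto intro!: backward_closed inverse_word_carrier)
  have neg: "Lp_energy p (- \<pi> ?W u) = Lp_energy p u" if "u \<in> Lp p" for u
    using Lp_energy_scaleR[of p "-1" "\<pi> ?W u"] \<pi>_energy[OF W that] by simp
  have p0: "0 \<le> p" using p by simp
  note cl = Lp_closed drift_closed W N M
  have "2 powr p * Lp_energy p (b ?W) = Lp_energy p (2 *\<^sub>R b ?W)"
    by (simp add: Lp_energy_scaleR)
  also have "2 *\<^sub>R b ?W = (?N + - \<pi> ?W ?M) + (drift + - \<pi> ?W drift)"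
    using forward_backward[OF assms] by (simp add: algebra_simps)
  also have "Lp_energy p \<dots> \<le> 2 powr p * (Lp_energy p (?N + - \<pi> ?W ?M) + Lp_energy p (drift + - \<pi> ?W drift))"
    by (intro Lp_energy_add_le p0 cl)
  also have "\<dots> \<le> 2 powr p * (2 powr p * (Lp_energy p ?N + Lp_energy p (- \<pi> ?W ?M))
       + 2 powr p * (Lp_energy p drift + Lp_energy p (- \<pi> ?W drift)))"
    by (intro mult_left_mono add_mono Lp_energy_add_le p0 cl) auto
  also have "\<dots> = 2 powr p * (2 powr p * (Lp_energy p ?N + Lp_energy p ?M + 2 * Lp_energy p drift))"
    using neg M drift_closed by (simp add: algebra_simps)
  finally show ?thesis by (rule mult_left_le_imp_le) simp
qed

text \<open>Inversion of words is a permutation of \<open>words X n\<close>, so both martingales in \<open>forward_backward\<close> have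
  the same total energy.\<close>

lemma cocycle_energy_growth:
  obtains K where "0 \<le> K"
    and "\<And>n. 0 < n \<Longrightarrow> (\<Sum>ws\<in>words X n. Lp_energy p (b (word_product G ws))) \<le> card X ^ n * (K * n powr (p / 2))"
proof
  define B where "B = exp (smooth_const p) * smooth_const p * increment_total"
  let ?K = "2 powr p * (2 * B + 2 * Lp_energy p drift)"
  have B: "0 \<le> B" using smooth_const_nonneg increment_total_nonneg by (simp add: B_def)
  then show "0 \<le> ?K" using Lp_energy_nonneg by simp
  fix n :: nat assume n: "0 < n"
  let ?e = "\<lambda>ws. Lp_energy p (backward ws)"
  have sw: "(\<Sum>ws\<in>words X n. ?e (inverse_word ws)) = backward_total n"
    unfolding backward_total_def
    by (rule sum.reindex_bij_witness[of _ inverse_word inverse_word])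
      (auto simp: inverse_word_words inverse_word_involution words_carrier)
  have "(\<Sum>ws\<in>words X n. Lp_energy p (b (word_product G ws)))
      \<le> (\<Sum>ws\<in>words X n. 2 powr p * (?e ws + ?e (inverse_word ws) + 2 * Lp_energy p drift))"
    by (intro sum_mono cocycle_energy_le words_carrier)
  also have "\<dots> = 2 powr p * (2 * backward_total n + card X ^ n * (2 * Lp_energy p drift))"
    unfolding sum_distrib_left[symmetric] sum.distrib sw
    by (simp add: backward_total_def card_words finX)
  also have "\<dots> \<le> 2 powr p * (2 * (card X ^ n * (B * n powr (p / 2))) + card X ^ n * (2 * Lp_energy p drift * n powr (p / 2)))"
  proof (intro mult_left_mono add_mono)
    show "backward_total n \<le> card X ^ n * (B * n powr (p / 2))"
      using backward_total_le[OF n] by (simp add: B_def)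
    have "1 \<le> real n powr (p / 2)" using n p by (intro ge_one_powr_ge_zero) auto
    then show "2 * Lp_energy p drift \<le> 2 * Lp_energy p drift * n powr (p / 2)"
      using mult_left_mono[of 1 "real n powr (p / 2)" "2 * Lp_energy p drift"] Lp_energy_nonneg[of p drift] by simp
  qed auto
  also have "\<dots> = card X ^ n * (?K * n powr (p / 2))" by (simp add: algebra_simps)
  finally show "(\<Sum>ws\<in>words X n. Lp_energy p (b (word_product G ws))) \<le> card X ^ n * (?K * n powr (p / 2))" .
qed

end

text \<open>Markov's inequality for the energy of the cocycle. At time \<open>L R\<close> the mean energy is
  \<open>O((L R) powr (p / 2))\<close>, whereas outside the ball of radius \<open>R\<close> the energy is at least
  \<open>c R powr (\<alpha> p)\<close>; as \<open>\<alpha> > 1 / 2\<close>, the latter wins for large \<open>R\<close> whatever \<open>L\<close> is.\<close>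

lemma (in Lp_cocycle_walk) amenable_of_cocycle_growth:
  assumes gen: "generate G X = carrier G" and c: "0 < c" and \<alpha>: "1 / 2 < \<alpha>"
    and lower: "\<And>g R. g \<in> carrier G \<Longrightarrow> g \<notin> reach R \<Longrightarrow> c * real R powr (\<alpha> * p) \<le> Lp_energy p (b g)"
  shows "amenable G"
proof (rule amenable_of_sublinear_escape[OF inv_X gen])
  fix L :: nat assume L: "0 < L"
  obtain K where K: "0 \<le> K" and growth: "\<And>n. 0 < n \<Longrightarrow>
      (\<Sum>ws\<in>words X n. Lp_energy p (b (word_product G ws))) \<le> card X ^ n * (K * n powr (p / 2))"
    by (rule cocycle_energy_growth) blast
  define \<beta> where "\<beta> = (\<alpha> - 1 / 2) * p"
  have \<beta>: "0 < \<beta>" using \<alpha> p by (simp add: \<beta>_def)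
  \<comment> \<open>The radius is chosen so that \<open>R powr \<beta>\<close>, the gain of \<open>R powr (\<alpha> p)\<close> over \<open>R powr (p / 2)\<close>, absorbs
    twice the constant in the growth bound.\<close>
  define Q where "Q = 2 * K * real L powr (p / 2) / c"
  have Q: "0 \<le> Q" using K c by (simp add: Q_def)
  define R where "R = max 3 (nat \<lceil>Q powr (1 / \<beta>)\<rceil>)"
  have R3: "3 \<le> R" by (simp add: R_def)
  have "Q powr (1 / \<beta>) \<le> real R"
    unfolding R_def by (meson max.cobounded2 of_nat_le_iff order_trans real_nat_ceiling_ge)
  then have "(Q powr (1 / \<beta>)) powr \<beta> \<le> real R powr \<beta>" using \<beta> by (intro powr_mono2) auto
  then have "Q \<le> real R powr \<beta>" using \<beta> Q by (simp add: powr_powr)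
  then have "Q * real R powr (p / 2) \<le> real R powr \<beta> * real R powr (p / 2)"
    by (rule mult_right_mono) simp
  also have "\<dots> = real R powr (\<alpha> * p)"
    by (simp add: powr_add[symmetric] \<beta>_def algebra_simps)
  finally have "Q * real R powr (p / 2) * c \<le> real R powr (\<alpha> * p) * c"
    using c by (intro mult_right_mono) auto
  moreover have "Q * real R powr (p / 2) * c = 2 * (K * real (L * R) powr (p / 2))"
    using c by (simp add: Q_def powr_mult)
  ultimately have scale: "2 * (K * real (L * R) powr (p / 2)) \<le> c * real R powr (\<alpha> * p)"
    by (simp add: mult.commute)
  let ?n = "L * R" and ?M = "c * real R powr (\<alpha> * p)"
  have n: "0 < ?n" using L R3 by simp
  have M: "0 < ?M" using c R3 by simp
  let ?far = "{ws \<in> words X ?n. word_product G ws \<notin> reach R}"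
  let ?near = "{ws \<in> words X ?n. word_product G ws \<in> reach R}"
  have fin: "finite (words X ?n)" by (simp add: finite_words finX)
  have "card ?far * ?M \<le> (\<Sum>ws\<in>?far. Lp_energy p (b (word_product G ws)))"
  proof (rule sum_bounded_below)
    fix ws assume "ws \<in> ?far"
    then show "?M \<le> Lp_energy p (b (word_product G ws))"
      using words_carrier by (intro lower word_product_closed) auto
  qed
  also have "\<dots> \<le> (\<Sum>ws\<in>words X ?n. Lp_energy p (b (word_product G ws)))"
    using fin by (intro sum_mono2) (auto simp: Lp_energy_nonneg)
  also have "\<dots> \<le> card X ^ ?n * (K * ?n powr (p / 2))" by (rule growth[OF n])
  finally have "2 * card ?far * ?M \<le> card X ^ ?n * (2 * (K * ?n powr (p / 2)))" by simp
  also have "\<dots> \<le> card X ^ ?n * ?M" using scale by (intro mult_left_mono) auto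
  finally have "real (2 * card ?far) * ?M \<le> real (card X ^ ?n) * ?M" by simp
  then have "real (2 * card ?far) \<le> real (card X ^ ?n)" using M by (rule mult_right_le_imp_le)
  then have "2 * card ?far \<le> card X ^ ?n" by (simp only: of_nat_le_iff)
  moreover have "card ?near + card ?far = card X ^ ?n"
  proof -
    have "card (?near \<union> ?far) = card ?near + card ?far" using fin by (intro card_Un_disjoint) auto
    moreover have "?near \<union> ?far = words X ?n" by blast
    ultimately show ?thesis by (simp add: card_words finX)
  qed
  ultimately have "card X ^ ?n \<le> 2 * card ?near" by linarith
  then show "\<exists>R\<ge>3. card X ^ (L * R) \<le> 2 * card {ws \<in> words X (L * R). word_product G ws \<in> reach R}"
    using R3 by blast
qed

section \<open>Word length and the compression exponent\<close>

lemma (in group) word_for_generated: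
  assumes S: "S \<subseteq> carrier G" "\<And>s. s \<in> S \<Longrightarrow> inv s \<in> S" and g: "g \<in> generate G S"
  shows "\<exists>ws. set ws \<subseteq> S \<and> word_product G ws = g"
  using g
proof (induction rule: generate.induct)
  case one
  then show ?case by (intro exI[of _ "[]"]) simp
next
  case (incl h)
  then show ?case using S by (intro exI[of _ "[h]"]) auto
next
  case (inv h)
  then show ?case using S by (intro exI[of _ "[inv h]"]) auto
next
  case (eng h1 h2)
  then obtain us vs where "set us \<subseteq> S" "word_product G us = h1" "set vs \<subseteq> S" "word_product G vs = h2"
    by blast
  then show ?case using S word_product_append[of us vs] by (intro exI[of _ "us @ vs"]) auto
qed

text \<open>Shorter words in \<open>S\<close> are padded with the letter \<open>\<one>\<close> to length exactly \<open>R\<close>.\<close>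

lemma reach_of_word_length_le:
  assumes "finite_walk G (insert \<one>\<^bsub>G\<^esub> S)"
    and sym: "\<And>s. s \<in> S \<Longrightarrow> inv\<^bsub>G\<^esub> s \<in> S" and g: "g \<in> generate G S"
    and len: "word_length G S g \<le> R"
  shows "g \<in> finite_walk.reach G (insert \<one>\<^bsub>G\<^esub> S) R"
proof -
  interpret finite_walk G "insert \<one>\<^bsub>G\<^esub> S" by fact
  have S: "S \<subseteq> carrier G" using X_carrier by simp
  have "\<exists>n ws. set ws \<subseteq> S \<and> length ws = n \<and> word_product G ws = g"
    using word_for_generated[OF S sym g] by blast
  then have "\<exists>ws. set ws \<subseteq> S \<and> length ws = word_length G S g \<and> word_product G ws = g"
    unfolding word_length_def by (rule LeastI_ex)
  then obtain ws where ws: "set ws \<subseteq> S" "length ws = word_length G S g" "word_product G ws = g" by blast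
  let ?ws = "ws @ replicate (R - length ws) \<one>\<^bsub>G\<^esub>"
  have "?ws \<in> words (insert \<one>\<^bsub>G\<^esub> S) R" using ws len by (auto simp: words_def)
  moreover have "word_product G ?ws = g"
    using ws S word_product_append[of ws] word_product_replicate_one word_product_closed[of ws] by (auto simp: subset_iff)
  ultimately show ?thesis unfolding reach_def by blast
qed

lemma Isom_Lp_D:
  assumes "T \<in> carrier (Isom_Lp p)" "u \<in> Lp p" "v \<in> Lp p"
  shows "T u \<in> Lp p" "T (u + v) = T u + T v" "Lp_norm p (T u) = Lp_norm p u" "inj_on T (Lp p)"
  using assms by (auto simp: Isom_Lp_def Bij_def bij_betw_def)

lemma Isom_Lp_mult:
  assumes "T \<in> carrier (Isom_Lp p)" "U \<in> carrier (Isom_Lp p)" "u \<in> Lp p"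
  shows "(T \<otimes>\<^bsub>Isom_Lp p\<^esub> U) u = T (U u)"
  using assms by (auto simp: Isom_Lp_def BijGroup_def compose_def)

theorem mainTheorem5:
  fixes G :: "('a, 'b) monoid_scheme" and S :: "'a set" and p :: real
  assumes "group G"
    and "infinite (carrier G)"
    and "finite_symmetric_generating_set G S"
    and "2 \<le> p"
    and "equivariant_compression_exponent G S p > 1 / 2"
  shows "amenable G"
proof -
  interpret group G by fact
  have S: "finite S" "S \<subseteq> carrier G" "\<And>s. s \<in> S \<Longrightarrow> inv\<^bsub>G\<^esub> s \<in> S" "generate G S = carrier G"
    using assms(3) by (auto simp: finite_symmetric_generating_set_def)
  have half: "(1 / 2 :: ereal) = ereal (1 / 2)" by (simp add: one_ereal_def)
  obtain \<alpha> \<psi> c where \<alpha>: "1 / 2 < \<alpha>" and eqv: "equivariant_Lp G p \<psi>" and c: "0 < c"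
    and comp: "\<And>x y. x \<in> carrier G \<Longrightarrow> y \<in> carrier G \<Longrightarrow> x \<noteq> y \<Longrightarrow>
        c * word_dist G S x y powr \<alpha> \<le> Lp_norm p (\<psi> x - \<psi> y)"
    using assms(5) unfolding equivariant_compression_exponent_def half less_Sup_iff by auto
  obtain \<pi> f v where \<pi>: "\<pi> \<in> hom G (Isom_Lp p)" and v: "v \<in> Lp p" and coc: "cocycle_Lp G p \<pi> f"
    and \<psi>: "\<And>x. x \<in> carrier G \<Longrightarrow> \<psi> x = \<pi> x v + f x"
    using eqv unfolding equivariant_Lp_def by blast
  have sub: "subspace (Lp p)" using subspace_Lp assms(4) by simp
  have \<pi>c: "\<pi> g \<in> carrier (Isom_Lp p)" if "g \<in> carrier G" for g using \<pi> that by (auto simp: hom_def)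
  have \<pi>m: "\<pi> (g \<otimes>\<^bsub>G\<^esub> h) u = \<pi> g (\<pi> h u)"
    if "g \<in> carrier G" "h \<in> carrier G" "u \<in> Lp p" for g h u
    using hom_mult[OF \<pi> that(1,2)] Isom_Lp_mult[OF \<pi>c \<pi>c] that by simp
  have \<pi>1: "\<pi> \<one>\<^bsub>G\<^esub> u = u" if u: "u \<in> Lp p" for u
  proof -
    have "\<pi> \<one>\<^bsub>G\<^esub> (\<pi> \<one>\<^bsub>G\<^esub> u) = \<pi> \<one>\<^bsub>G\<^esub> u" using \<pi>m[of "\<one>\<^bsub>G\<^esub>" "\<one>\<^bsub>G\<^esub>" u] u by simp
    then show ?thesis
      using Isom_Lp_D(1,4)[OF \<pi>c[OF one_closed] u u] u by (auto dest: inj_onD)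
  qed
  have f: "f g \<in> Lp p" "f (g \<otimes>\<^bsub>G\<^esub> h) = \<pi> g (f h) + f g" if "g \<in> carrier G" "h \<in> carrier G" for g h
    using coc that by (auto simp: cocycle_Lp_def)
  let ?X = "insert \<one>\<^bsub>G\<^esub> S"
  \<comment> \<open>An orbit map minus its value at \<open>\<one>\<close> is again a cocycle, cohomologous to \<open>f\<close>.\<close>
  define b where "b g = \<psi> g - v" for g
  have b_closed: "b g \<in> Lp p" if "g \<in> carrier G" for g
    unfolding b_def \<psi>[OF that]
    by (intro subspace_add[OF sub] subspace_diff[OF sub] Isom_Lp_D(1)[OF \<pi>c[OF that] v v] f(1)[OF that that] v)
  have b_mult: "b (g \<otimes>\<^bsub>G\<^esub> h) = \<pi> g (b h) + b g" if g: "g \<in> carrier G" and h: "h \<in> carrier G" for g h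
  proof -
    have "\<pi> g (b h + v) = \<pi> g (b h) + \<pi> g v"
      by (rule Isom_Lp_D(2)[OF \<pi>c[OF g] b_closed[OF h] v])
    moreover have "\<pi> g (\<pi> h v + f h) = \<pi> g (\<pi> h v) + \<pi> g (f h)"
      by (rule Isom_Lp_D(2)[OF \<pi>c[OF g] Isom_Lp_D(1)[OF \<pi>c[OF h] v v] f(1)[OF h h]])
    ultimately show ?thesis
      using g h \<pi>m[OF g h v] f(2)[OF g h] by (simp add: b_def \<psi> algebra_simps)
  qed
  interpret Lp_cocycle_walk G ?X p \<pi> b
  proof unfold_locales
    show "inv\<^bsub>G\<^esub> x \<in> ?X" if "x \<in> ?X" for x using that S(3) by auto
    show "Lp_energy p (\<pi> g u) = Lp_energy p u" if "g \<in> carrier G" "u \<in> Lp p" for g u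
      using Isom_Lp_D(3)[OF \<pi>c[OF that(1)] that(2) that(2)] assms(4) by (simp add: Lp_energy_eq)
  qed (use S assms(4) Isom_Lp_D(1,2)[OF \<pi>c] \<pi>m \<pi>1 b_closed b_mult in auto)
  have walk: "finite_walk G ?X" by unfold_locales
  show ?thesis
  proof (rule amenable_of_cocycle_growth)
    have "generate G S \<subseteq> generate G ?X" by (rule mono_generate) auto
    then show "generate G ?X = carrier G" using S(4) generate_incl[OF X_carrier] by auto
    show "0 < c powr p" using c by simp
    show "1 / 2 < \<alpha>" by (rule \<alpha>)
    fix g R assume g: "g \<in> carrier G" and far: "g \<notin> reach R"
    have "R < word_length G S g"
      using reach_of_word_length_le[OF walk S(3), of g R] far g S(4) by force
    then have dist: "real R \<le> word_dist G S \<one>\<^bsub>G\<^esub> g" using g by (simp add: word_dist_def)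
    have "\<one>\<^bsub>G\<^esub> \<noteq> g" using one_reach far by blast
    have "c * real R powr \<alpha> \<le> c * word_dist G S \<one>\<^bsub>G\<^esub> g powr \<alpha>"
      using c \<alpha> dist by (intro mult_left_mono powr_mono2) auto
    also have "\<dots> \<le> Lp_norm p (\<psi> \<one>\<^bsub>G\<^esub> - \<psi> g)" by (rule comp) (use g \<open>\<one>\<^bsub>G\<^esub> \<noteq> g\<close> in auto)
    finally have "(c * real R powr \<alpha>) powr p \<le> Lp_norm p (\<psi> \<one>\<^bsub>G\<^esub> - \<psi> g) powr p"
      using c assms(4) by (intro powr_mono2) auto
    also have "\<dots> = Lp_energy p (\<psi> \<one>\<^bsub>G\<^esub> - \<psi> g)" using assms(4) by (simp add: Lp_energy_eq)
    also have "\<psi> \<one>\<^bsub>G\<^esub> - \<psi> g = (- 1) *\<^sub>R b g" using b_one by (simp add: b_def)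
    also have "Lp_energy p \<dots> = Lp_energy p (b g)" unfolding Lp_energy_scaleR by simp
    finally show "c powr p * real R powr (\<alpha> * p) \<le> Lp_energy p (b g)"
      using c by (simp add: powr_mult powr_powr)
  qed
qed

end
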